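(* Let $f=\frac1n\sum_{i=1}^n f_i$ with $f_i:\mathbb{R}^d\to\mathbb{R}$, where $f$ is differentiable and $L$-smooth, i.e. $\|\nabla f(x)-\nabla f(y)\|\le L\|x-y\|$ for all $x,y$, and bounded below by $f^*\in\mathbb{R}$. For each $i\in[n]$, let worker $i$ be able to compute only stochastic gradients $\nabla f_i(x;\xi_i)$, $\xi_i\sim\mathcal{D}_i$, with $\mathbb{E}_{\xi_i}[\nabla f_i(x;\xi_i)]=\nabla f_i(x)$ and $\mathbb{E}_{\xi_i}[\|\nabla f_i(x;\xi_i)-\nabla f_i(x)\|^2]\le\sigma^2$ for all $x\in\mathbb{R}^d$, where $\sigma^2\ge0$. Let the computation powers $v_1,\dots,v_n:\mathbb{R}_+\to\mathbb{R}_+$ be non-negative and continuous almost everywhere, with $V_i(t)=\int_0^t v_i(\tau)d\tau$. Let $\varepsilon>0$, let $x^0\in\mathbb{R}^d$ be the starting point and $\Delta:=f(x^0)-f^*$. Run Malenia SGD with parameter $S=\max\{\lceil\sigma^2/\varepsilon\rceil,n\}$ and stepsize $\gamma=\min\{\frac1L,\frac{\varepsilon S}{2L\sigma^2}\}$. Define $\bar t_0=0$ and, for all $k\ge1$, $$\bar t_k:=\min\left\{t\ge0:\left(\frac1n\sum_{i=1}^n\big\lfloor V_i(t)-V_i(\bar t_{k-1})\big\rfloor^{-1}\right)^{-1}\ge\max\Big\{\frac{2\sigma^2}{n\varepsilon},1\Big\}\right\}.$$ Then Malenia SGD converges after at most $\bar t_{\lceil 24L\Delta/\varepsilon\rceil}$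 seconds; that is, with $K=\lceil 24L\Delta/\varepsilon\rceil$, the first $K$ iterations of the method are completed by time $\bar t_K$, and (if $K\ge1$) the iterates satisfy $\frac1K\sum_{k=0}^{K-1}\mathbb{E}[\|\nabla f(x^k)\|^2]\le\varepsilon$.
   Context: Notation: $\mathbb{R}_+=[0,\infty)$, $[n]=\{1,\dots,n\}$. Conventions: $\min\emptyset=\infty$, $0^{-1}=\infty$, $\infty^{-1}=0$, $\bar t_k=\infty$ if $\bar t_{k-1}=\infty$, and $\frac{\varepsilon S}{2L\sigma^2}=\infty$ if $\sigma^2=0$. Computation model: $n$ workers compute in parallel, time starts at $0$, and communication and server updates take no time. $V_i$ (Riemann integral) is finite, continuous and non-decreasing on $\mathbb{R}_+$. If worker $i$ starts computing at time $t_0$ and works without being stopped (starting a new stochastic gradient as soon as the previous one is finished), then by time $t_1\ge t_0$ it has finished $\lfloor V_i(t_1)-V_i(t_0)\rfloor$ stochastic gradients. Stopping a worker discards its unfinished computation. The computation powers are independent of the stochastic gradient noise. Malenia SGD (input: $x^0$, stepsize $\gamma$, parameter $S$): for $k=0,1,\dots$: the server asks all workers to compute stochastic gradients at $x^k$ and sets $g_i^k=0$, $B_i=0$ for all $i$; while $\left(\frac1n\sum_{i=1}^n\frac1{B_i}\right)^{-1}<\frac Sn$: wait for the next worker $j$ to finish, set $B_j\leftarrow B_j+1$, receive its stochastic gradient $\nabla f_j(x^k;\xi^k_{j,B_j})$ (with independent samples $\xi^k_{j,b}\sim\mathcal{D}_j$), set $g_j^k\leftarrow g_j^k+\nabla f_j(x^k;\xi^k_{j,B_j})$,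 and ask this worker to compute another stochastic gradient at $x^k$. When the loop ends, the server sets $g^k=\frac1n\sum_{i=1}^n\frac1{B_i}g_i^k$, $x^{k+1}=x^k-\gamma g^k$, stops all the workers' computations, and goes to the next iteration. *)

theory Defs
  imports "HOL-Probability.Probability"
begin

definition gradient :: "('a::real_inner \<Rightarrow> real) \<Rightarrow> 'a \<Rightarrow> 'a" where
  "gradient f x = (THE D. GDERIV f x :> D)"

(* Workers are 1..n.  The arithmetic is that of ereal, where inverse 0 = \<infinity> and inverse \<infinity> = 0,
   so the mean is 0 as soon as some b i is 0 (and no b i is negative). *)
definition harmonic_mean :: "nat \<Rightarrow> (nat \<Rightarrow> real) \<Rightarrow> ereal" where
  "harmonic_mean n b = inverse (ereal (1 / real n) * (\<Sum>i=1..n. inverse (ereal (b i))))"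

(* Here and in finish_time the infimum is taken in ereal, so it is \<infinity> for the empty set.  For
   non-empty sets it is a minimum whenever the V i are continuous and non-decreasing, since then
   t \<mapsto> \<lfloor>V i t - c\<rfloor> is non-decreasing and right-continuous. *)
primrec tbar :: "nat \<Rightarrow> (nat \<Rightarrow> real \<Rightarrow> real) \<Rightarrow> real \<Rightarrow> real \<Rightarrow> nat \<Rightarrow> ereal" where
  "tbar n V \<sigma> \<epsilon> 0 = 0"
| "tbar n V \<sigma> \<epsilon> (Suc k) =
     (if tbar n V \<sigma> \<epsilon> k = \<infinity> then \<infinity>
      else Inf {ereal t | t. 0 \<le> t \<and>
             harmonic_mean n (\<lambda>i. of_int \<lfloor>V i t - V i (real_of_ereal (tbar n V \<sigma> \<epsilon> k))\<rfloor>)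
               \<ge> ereal (max (2 * \<sigma>\<^sup>2 / (real n * \<epsilon>)) 1)})"

(* The time at which a worker with cumulative computation power V, started at time s and never
   stopped, finishes its b-th stochastic gradient; \<infinity> if this never happens. *)
definition finish_time :: "(real \<Rightarrow> real) \<Rightarrow> real \<Rightarrow> nat \<Rightarrow> ereal" where
  "finish_time V s b = Inf {ereal t | t. s \<le> t \<and> int b \<le> \<lfloor>V t - V s\<rfloor>}"

(* A schedule J :: nat \<Rightarrow> nat \<Rightarrow> nat gives the order of arrival: J k m is the worker from which the
   server receives the (m+1)-st stochastic gradient of iteration k.  Within one iteration,
   received (J k) m i and grad_sum G x \<xi> (J k) m i are the values of B_i and g_i after m receptions;
   the b-th gradient of worker j at x is G j x (\<xi> j b). *)
primrec received :: "(nat \<Rightarrow> nat) \<Rightarrow> nat \<Rightarrow> nat \<Rightarrow> nat" where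
  "received w 0 = (\<lambda>_. 0)"
| "received w (Suc m) = (received w m)(w m := received w m (w m) + 1)"

primrec grad_sum :: "(nat \<Rightarrow> 'a \<Rightarrow> 's \<Rightarrow> 'a) \<Rightarrow> 'a \<Rightarrow> (nat \<Rightarrow> nat \<Rightarrow> 's) \<Rightarrow> (nat \<Rightarrow> nat) \<Rightarrow>
    nat \<Rightarrow> nat \<Rightarrow> 'a::real_vector" where
  "grad_sum G x \<xi> w 0 = (\<lambda>_. 0)"
| "grad_sum G x \<xi> w (Suc m) = (let j = w m in
     (grad_sum G x \<xi> w m)(j := grad_sum G x \<xi> w m j + G j x (\<xi> j (received w (Suc m) j))))"

definition loop_continues :: "nat \<Rightarrow> real \<Rightarrow> (nat \<Rightarrow> nat) \<Rightarrow> nat \<Rightarrow> bool" where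
  "loop_continues n S w m \<longleftrightarrow> harmonic_mean n (\<lambda>i. real (received w m i)) < ereal (S / real n)"

(* Meaningful only if the loop ends. *)
definition num_receptions :: "nat \<Rightarrow> real \<Rightarrow> (nat \<Rightarrow> nat) \<Rightarrow> nat" where
  "num_receptions n S w = (LEAST m. \<not> loop_continues n S w m)"

(* Completion time of the first k iterations: the next iteration starts when the last gradient
   needed by the current one is finished, and the time is \<infinity> if some iteration never ends (either
   because its loop does not end, or because the schedule uses a gradient that is never finished). *)
primrec iteration_time :: "nat \<Rightarrow> (nat \<Rightarrow> real \<Rightarrow> real) \<Rightarrow> real \<Rightarrow> (nat \<Rightarrow> nat \<Rightarrow> nat) \<Rightarrow> nat \<Rightarrow> ereal" where
  "iteration_time n V S J 0 = 0"
| "iteration_time n V S J (Suc k) =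
     (if iteration_time n V S J k = \<infinity> \<or> (\<forall>m. loop_continues n S (J k) m) then \<infinity>
      else let N = num_receptions n S (J k); j = J k (N - 1) in
        finish_time (V j) (real_of_ereal (iteration_time n V S J k)) (received (J k) N j))"

(* While the loop runs, the next gradient comes from a worker that is next to finish.  Workers
   finishing at the same time may be served in any order.  If no worker ever finishes again, all
   the finish times compared are \<infinity>, the choice is immaterial, and iteration_time is \<infinity>. *)
definition valid_schedule :: "nat \<Rightarrow> (nat \<Rightarrow> real \<Rightarrow> real) \<Rightarrow> real \<Rightarrow> (nat \<Rightarrow> nat \<Rightarrow> nat) \<Rightarrow> bool" where
  "valid_schedule n V S J \<longleftrightarrow>
     (\<forall>k m. iteration_time n V S J k < \<infinity> \<and> (\<forall>l\<le>m. loop_continues n S (J k) l) \<longrightarrow>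
        (let s = real_of_ereal (iteration_time n V S J k); B = received (J k) m; j = J k m in
          j \<in> {1..n} \<and>
          (\<forall>i\<in>{1..n}. finish_time (V j) s (B j + 1) \<le> finish_time (V i) s (B i + 1))))"

(* \<xi> k j b is the sample used in iteration k for the b-th gradient of worker j (b \<ge> 1). *)
primrec malenia_sgd :: "nat \<Rightarrow> real \<Rightarrow> real \<Rightarrow> (nat \<Rightarrow> 'a \<Rightarrow> 's \<Rightarrow> 'a) \<Rightarrow> (nat \<Rightarrow> nat \<Rightarrow> nat \<Rightarrow> 's) \<Rightarrow>
    (nat \<Rightarrow> nat \<Rightarrow> nat) \<Rightarrow> 'a \<Rightarrow> nat \<Rightarrow> 'a::real_vector" where
  "malenia_sgd n S \<gamma> G \<xi> J x0 0 = x0"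
| "malenia_sgd n S \<gamma> G \<xi> J x0 (Suc k) =
     (let x = malenia_sgd n S \<gamma> G \<xi> J x0 k;
          N = num_receptions n S (J k);
          B = received (J k) N;
          g = grad_sum G x (\<xi> k) (J k) N
      in x - \<gamma> *\<^sub>R ((1 / real n) *\<^sub>R (\<Sum>i=1..n. (1 / real (B i)) *\<^sub>R g i)))"

end

theory Submission
  imports Defs
begin

text \<open>
  The assertion on time and the assertion on the iterates have independent proofs; they share only
  the order of arrivals \<open>J\<close> and the target \<open>S / n\<close> for the harmonic mean of the batch sizes.

  \<^bold>\<open>Time.\<close>  The threshold in the recursion for \<open>tbar\<close> is at least \<open>S / n\<close>
  (\<open>batch_threshold\<close>).  Suppose that an iteration starts at \<open>s\<close>, not later than the corresponding
  \<open>tbar\<close>, and that \<open>t\<close> is admissible for the next \<open>tbar\<close>.  An early start only helps, so the numbers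
  \<open>c i = \<lfloor>V i t - V i s\<rfloor>\<close> of gradients that the workers can finish during \<open>[s, t]\<close> have harmonic
  mean at least \<open>S / n\<close>.  While the loop is running, its batch has a smaller harmonic mean, hence
  some worker \<open>i\<close> has delivered fewer than \<open>c i\<close> gradients, and its next one is ready by time \<open>t\<close>.
  The server takes the earliest arrival, so what it receives is also ready by time \<open>t\<close>.  Thus no
  worker \<open>i\<close> ever delivers more than \<open>c i\<close> gradients, so the loop ends, and it ends by time \<open>t\<close>
  (\<open>loop_ends_in_time\<close>).  Induction over the iterations gives \<open>iteration_time_le_tbar\<close>.

  \<^bold>\<open>Convergence.\<close>  The order of arrivals is not random, so the batch sizes \<open>B i\<close> are constants and
  \<open>g = \<nabla>f(x) + e\<close>, where the error \<open>e\<close> is a weighted sum of centred gradients at fresh samples.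
  Each of them is orthogonal in \<open>L\<^sup>2\<close> to everything that is determined by the other samples
  (\<open>fresh_noise_orthogonal\<close>, \<open>minibatch_noise\<close>).  Hence \<open>e\<close> is orthogonal to \<open>\<nabla>f(x)\<close>, and its
  second moment is at most \<open>(\<sigma>\<^sup>2 / n)\<close> times the mean of the \<open>1 / B i\<close>, which is at most
  \<open>\<sigma>\<^sup>2 / S\<close> because the loop runs until the harmonic mean of the \<open>B i\<close> has reached \<open>S / n\<close>.  The descent
  inequality for an \<open>L\<close>-smooth function turns this into the expected decrease
  \<open>E f(x') \<le> E f(x) - \<gamma>/2 E \<parallel>\<nabla>f(x)\<parallel>\<^sup>2 + L \<gamma>\<^sup>2 \<sigma>\<^sup>2 / (2 S)\<close> (\<open>malenia_step\<close>), and summation over the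
  iterations bounds the average squared gradient norm (\<open>malenia_average_gradient\<close>).  The stepsize
  enters through \<open>1 / (2 L) \<le> \<gamma> \<le> 1 / L\<close> and \<open>L \<gamma> \<sigma>\<^sup>2 / S \<le> \<epsilon> / 2\<close>.

  The last of the \<open>K\<close> iterations is assumed to start but not to end, so there may be no stochastic
  step after it.  The sum is closed with an exact gradient step instead: it decreases \<open>f\<close> by at least
  \<open>\<gamma>/2 \<parallel>\<nabla>f(x)\<parallel>\<^sup>2\<close>, and \<open>f\<close> stays above its lower bound (\<open>gradient_step_decrease\<close>).
\<close>

section \<open>Gradients and the descent inequality\<close>

lemma gradient_eqI:
  assumes "GDERIV f x :> D" shows "gradient f x = D"
  unfolding gradient_def
proof (rule the_equality)
  show "GDERIV f x :> D" by (rule assms)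
next
  fix D' assume "GDERIV f x :> D'"
  then have "(\<lambda>h. h \<bullet> D') = (\<lambda>h. h \<bullet> D)"
    using assms unfolding gderiv_def by (rule has_derivative_unique)
  then have "(D' - D) \<bullet> D' = (D' - D) \<bullet> D" by (rule fun_cong)
  then have "(D' - D) \<bullet> (D' - D) = 0" by (simp add: inner_diff_right)
  then show "D' = D" by simp
qed

text \<open>
  The Riesz representation of the derivative: on a Euclidean space the vector of its values on the
  basis represents it.
\<close>

lemma GDERIV_gradient:
  fixes f :: "'a::euclidean_space \<Rightarrow> real"
  assumes "f differentiable (at x)"
  shows "GDERIV f x :> gradient f x"
proof -
  obtain f' where f': "(f has_derivative f') (at x)"
    using assms by (auto simp: differentiable_def)
  then interpret bounded_linear f' by (rule has_derivative_bounded_linear)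
  have "f' h = h \<bullet> (\<Sum>b\<in>Basis. f' b *\<^sub>R b)" for h
  proof -
    have "f' h = f' (\<Sum>b\<in>Basis. (h \<bullet> b) *\<^sub>R b)" by (simp only: euclidean_representation)
    also have "\<dots> = (\<Sum>b\<in>Basis. (h \<bullet> b) * f' b)" by (simp add: sum scaleR)
    finally show ?thesis by (simp add: inner_sum_right mult.commute)
  qed
  then have "GDERIV f x :> (\<Sum>b\<in>Basis. f' b *\<^sub>R b)"
    using f' unfolding gderiv_def by (metis (no_types, lifting) ext)
  then show ?thesis using gradient_eqI by metis
qed

lemma gradient_scaled_sum:
  fixes fs :: "'i \<Rightarrow> 'a::euclidean_space \<Rightarrow> real"
  assumes "\<And>i. i \<in> I \<Longrightarrow> fs i differentiable (at x)"
  shows "gradient (\<lambda>y. c * (\<Sum>i\<in>I. fs i y)) x = c *\<^sub>R (\<Sum>i\<in>I. gradient (fs i) x)"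
proof (rule gradient_eqI)
  have "(fs i has_derivative (\<lambda>h. h \<bullet> gradient (fs i) x)) (at x)" if "i \<in> I" for i
    using GDERIV_gradient[OF assms[OF that]] by (simp add: gderiv_def)
  then have "((\<lambda>y. c * (\<Sum>i\<in>I. fs i y)) has_derivative
      (\<lambda>h. c * (\<Sum>i\<in>I. h \<bullet> gradient (fs i) x))) (at x)"
    by (intro has_derivative_mult_right has_derivative_sum)
  then show "GDERIV (\<lambda>y. c * (\<Sum>i\<in>I. fs i y)) x :> c *\<^sub>R (\<Sum>i\<in>I. gradient (fs i) x)"
    by (simp add: gderiv_def inner_sum_right)
qed

text \<open>
  Along the segment from \<open>x\<close> to \<open>x + d\<close>, subtract from \<open>f\<close> the claimed quadratic bound.  By
  the Lipschitz condition and Cauchy--Schwarz the difference has a nonpositive derivative, so it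
  does not increase.
\<close>

lemma descent_inequality:
  fixes f :: "'a::euclidean_space \<Rightarrow> real"
  assumes diff: "\<And>y. f differentiable (at y)"
    and smooth: "\<And>y z. norm (gradient f y - gradient f z) \<le> L * norm (y - z)"
  shows "f (x + d) \<le> f x + gradient f x \<bullet> d + L / 2 * (norm d)\<^sup>2"
proof -
  define \<phi> where "\<phi> t = f (x + t *\<^sub>R d) - t * (gradient f x \<bullet> d) - L / 2 * t\<^sup>2 * (norm d)\<^sup>2" for t
  define \<phi>' where "\<phi>' t = (gradient f (x + t *\<^sub>R d) - gradient f x) \<bullet> d - L * t * (norm d)\<^sup>2" for t
  have deriv: "(\<phi> has_real_derivative \<phi>' t) (at t)" for t
  proof -
    have "((\<lambda>t. f (x + t *\<^sub>R d)) has_derivative (\<lambda>h. (h *\<^sub>R d) \<bullet> gradient f (x + t *\<^sub>R d))) (at t)"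
      using GDERIV_gradient[OF diff, of "x + t *\<^sub>R d"] unfolding gderiv_def
      by (rule has_derivative_compose[rotated]) (auto intro!: derivative_eq_intros)
    then have "((\<lambda>t. f (x + t *\<^sub>R d)) has_real_derivative d \<bullet> gradient f (x + t *\<^sub>R d)) (at t)"
      by (rule has_derivative_imp_has_field_derivative) simp
    then show ?thesis unfolding \<phi>_def[abs_def] \<phi>'_def
      by (auto intro!: derivative_eq_intros simp: inner_diff_left inner_commute algebra_simps)
  qed
  have "\<phi> 1 \<le> \<phi> 0"
  proof (rule DERIV_nonpos_imp_nonincreasing[where f = \<phi>])
    fix t :: real assume t: "0 \<le> t" "t \<le> 1"
    have "(gradient f (x + t *\<^sub>R d) - gradient f x) \<bullet> d
        \<le> norm (gradient f (x + t *\<^sub>R d) - gradient f x) * norm d"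
      by (rule norm_cauchy_schwarz)
    also have "\<dots> \<le> (L * norm (x + t *\<^sub>R d - x)) * norm d"
      by (intro mult_right_mono smooth) auto
    also have "\<dots> = L * t * (norm d)\<^sup>2" using t by (simp add: power2_eq_square)
    finally have "\<phi>' t \<le> 0" by (simp add: \<phi>'_def)
    with deriv show "\<exists>y. (\<phi> has_real_derivative y) (at t) \<and> y \<le> 0" by blast
  qed simp
  then show ?thesis by (simp add: \<phi>_def)
qed

text \<open>
  An exact gradient step from \<open>x\<close> lowers \<open>f\<close> by the left-hand side and cannot pass below the
  lower bound.  With \<open>\<gamma> = 1 / L\<close> this controls the gradient norm by the value of \<open>f\<close>, which gives
  integrability of the former from that of the latter.
\<close>

lemma gradient_step_decrease:
  fixes f :: "'a::euclidean_space \<Rightarrow> real"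
  assumes diff: "\<And>y. f differentiable (at y)"
    and smooth: "\<And>y z. norm (gradient f y - gradient f z) \<le> L * norm (y - z)"
    and bounded: "\<And>y. fstar \<le> f y" and \<gamma>: "0 \<le> \<gamma>" "L * \<gamma> \<le> 1"
  shows "\<gamma> / 2 * (norm (gradient f x))\<^sup>2 \<le> f x - fstar"
proof -
  let ?g = "gradient f x"
  have "fstar \<le> f (x + (- \<gamma>) *\<^sub>R ?g)" by (rule bounded)
  also have "\<dots> \<le> f x + ?g \<bullet> ((- \<gamma>) *\<^sub>R ?g) + L / 2 * (norm ((- \<gamma>) *\<^sub>R ?g))\<^sup>2"
    by (rule descent_inequality[OF diff smooth])
  also have "\<dots> = f x - \<gamma> * (norm ?g)\<^sup>2 + (L * \<gamma>) * (\<gamma> / 2 * (norm ?g)\<^sup>2)"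
    by (simp add: power_mult_distrib power2_norm_eq_inner) (simp add: power2_eq_square)
  also have "\<dots> \<le> f x - \<gamma> * (norm ?g)\<^sup>2 + 1 * (\<gamma> / 2 * (norm ?g)\<^sup>2)"
    using \<gamma> by (intro add_left_mono mult_right_mono) auto
  finally show ?thesis by simp
qed

section \<open>Harmonic means\<close>

lemma harmonic_mean_mono:
  assumes "\<And>i. i \<in> {1..n} \<Longrightarrow> 0 \<le> b i \<and> b i \<le> c i"
  shows "harmonic_mean n b \<le> harmonic_mean n c"
  unfolding harmonic_mean_def
proof (rule ereal_inverse_antimono)
  show "ereal (1 / real n) * (\<Sum>i=1..n. inverse (ereal (c i)))
      \<le> ereal (1 / real n) * (\<Sum>i=1..n. inverse (ereal (b i)))"
    using assms by (intro ereal_mult_left_mono sum_mono ereal_inverse_antimono) auto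
  have "0 \<le> inverse (ereal (c i))" if "i \<in> {1..n}" for i
    using assms[OF that] by (intro inverse_ereal_ge0I) simp
  then show "0 \<le> ereal (1 / real n) * (\<Sum>i=1..n. inverse (ereal (c i)))"
    by (intro ereal_0_le_mult sum_nonneg) auto
qed

lemma harmonic_mean_eq_0:
  assumes "i \<in> {1..n}" "b i = 0"
  shows "harmonic_mean n b = 0"
proof -
  have "(\<Sum>i=1..n. inverse (ereal (b i))) = \<infinity>"
    using assms by (auto simp: sum_Pinfty)
  with assms show ?thesis by (simp add: harmonic_mean_def)
qed

lemma harmonic_mean_nonzero:
  assumes "\<And>i. i \<in> {1..n} \<Longrightarrow> b i \<noteq> 0" "n \<ge> 1" and "(\<Sum>i=1..n. 1 / b i) \<noteq> 0"
  shows "harmonic_mean n b = ereal (1 / ((1 / real n) * (\<Sum>i=1..n. 1 / b i)))"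
proof -
  have "(\<Sum>i=1..n. inverse (ereal (b i))) = (\<Sum>i=1..n. ereal (1 / b i))"
    using assms by (intro sum.cong) (auto simp: divide_inverse)
  then show ?thesis using assms by (simp add: harmonic_mean_def divide_inverse)
qed

text \<open>
  Excludes times before the start of an iteration from the infimum that defines \<open>tbar\<close>: there, all
  the rounded increments of the \<open>V i\<close> are zero or negative.
\<close>

lemma harmonic_mean_nonpos:
  assumes "\<And>i. i \<in> {1..n} \<Longrightarrow> b i \<le> 0" "n \<ge> 1"
  shows "harmonic_mean n b \<le> 0"
proof (cases "\<exists>i\<in>{1..n}. b i = 0")
  case True
  then show ?thesis using harmonic_mean_eq_0 by force
next
  case False
  have neg: "(\<Sum>i=1..n. 1 / b i) < 0"
    using False assms sum_strict_mono[of "{1..n}" "\<lambda>i. 1 / b i" "\<lambda>_. 0"]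
    by (auto simp: less_le)
  then show ?thesis using False assms
    by (subst harmonic_mean_nonzero) (auto simp: divide_le_0_iff mult_le_0_iff)
qed

text \<open>
  What the stopping criterion of the loop says about real numbers: every worker has contributed, and
  the mean of the inverse batch sizes, which governs the variance, is small.
\<close>

lemma harmonic_mean_ge_pos:
  assumes nonneg: "\<And>i. i \<in> {1..n} \<Longrightarrow> 0 \<le> b i" and n: "n \<ge> 1"
    and c: "ereal c \<le> harmonic_mean n b" "c > 0"
  shows "\<And>i. i \<in> {1..n} \<Longrightarrow> 0 < b i" and "(1 / real n) * (\<Sum>i=1..n. 1 / b i) \<le> 1 / c"
proof -
  show pos: "0 < b i" if "i \<in> {1..n}" for i
    using nonneg[OF that] harmonic_mean_eq_0[OF that, of b] c by (cases "b i = 0") auto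
  have "(\<Sum>i=1..n. 1 / b i) > 0" using pos n by (intro sum_pos) auto
  moreover from this have "c \<le> 1 / ((1 / real n) * (\<Sum>i=1..n. 1 / b i))"
    using c(1) pos n by (subst (asm) harmonic_mean_nonzero) force+
  ultimately show "(1 / real n) * (\<Sum>i=1..n. 1 / b i) \<le> 1 / c"
    using n c(2) by (simp add: field_simps)
qed

section \<open>Completion times\<close>

lemma finish_time_ge: "ereal s \<le> finish_time V s b"
  unfolding finish_time_def by (rule Inf_greatest) auto

text \<open>
  The infimum in \<open>finish_time\<close> is attained.  If \<open>V t - V s\<close> were below \<open>b\<close>, continuity would keep
  \<open>V - V s\<close> below \<open>b\<close> a little beyond \<open>t\<close>, and monotonicity before that, so that the infimum would
  exceed \<open>t\<close>.
\<close>

lemma finish_time_le_iff: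
  assumes mono: "mono_on {0..} V" and cont: "continuous_on {0..} V"
    and s: "0 \<le> s" "s \<le> t"
  shows "finish_time V s b \<le> ereal t \<longleftrightarrow> int b \<le> \<lfloor>V t - V s\<rfloor>"
proof
  assume "int b \<le> \<lfloor>V t - V s\<rfloor>"
  then show "finish_time V s b \<le> ereal t"
    unfolding finish_time_def using s by (intro Inf_lower) auto
next
  assume le: "finish_time V s b \<le> ereal t"
  show "int b \<le> \<lfloor>V t - V s\<rfloor>"
  proof (rule ccontr)
    assume "\<not> int b \<le> \<lfloor>V t - V s\<rfloor>"
    then have "V t < V s + real b" by (simp add: le_floor_iff)
    moreover have "(V \<longlongrightarrow> V t) (at t within {0..})"
      using cont s by (auto simp: continuous_on_def)
    ultimately have "\<forall>\<^sub>F u in at t within {0..}. V u < V s + real b"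
      by (rule order_tendstoD(2)[rotated])
    then obtain \<delta> where \<delta>: "\<delta> > 0"
        "\<And>u. 0 \<le> u \<Longrightarrow> u \<noteq> t \<Longrightarrow> dist u t < \<delta> \<Longrightarrow> V u < V s + real b"
      by (auto simp: eventually_at)
    have "t + \<delta> / 2 \<le> u" if u: "s \<le> u" "int b \<le> \<lfloor>V u - V s\<rfloor>" for u
    proof (rule ccontr)
      assume "\<not> t + \<delta> / 2 \<le> u"
      then have "V u \<le> V (t + \<delta> / 2)"
        using u s \<delta>(1) by (intro mono_onD[OF mono]) auto
      also have "\<dots> < V s + real b" using \<delta> s by (intro \<delta>(2)) (auto simp: dist_real_def)
      finally show False using u(2) by (simp add: le_floor_iff)
    qed
    then have "ereal (t + \<delta> / 2) \<le> finish_time V s b"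
      unfolding finish_time_def by (intro Inf_greatest) auto
    with le have "ereal (t + \<delta> / 2) \<le> ereal t" by (rule order.trans[rotated])
    with \<delta>(1) show False by simp
  qed
qed

lemma sum_received:
  assumes "\<And>l. l < m \<Longrightarrow> w l \<in> {1..n}"
  shows "(\<Sum>i=1..n. received w m i) = m"
  using assms
proof (induction m)
  case (Suc m)
  have "(\<Sum>i=1..n. received w (Suc m) i)
      = (\<Sum>i=1..n. received w m i + (if i = w m then 1 else 0))"
    by (intro sum.cong) auto
  also have "\<dots> = m + 1" using Suc by (simp add: sum.distrib)
  finally show ?case by simp
qed simp

lemma not_loop_continues_iff:
  "\<not> loop_continues n S w m \<longleftrightarrow> ereal (S / real n) \<le> harmonic_mean n (\<lambda>i. real (received w m i))"
  by (auto simp: loop_continues_def)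

lemma num_receptions_ends:
  assumes "\<exists>m. \<not> loop_continues n S w m"
  shows "\<not> loop_continues n S w (num_receptions n S w)"
  unfolding num_receptions_def using assms by (rule LeastI_ex)

text \<open>
  Here \<open>w\<close> is the order of arrivals of an iteration that starts at \<open>s\<close>, and \<open>next_worker\<close> says that
  the server always takes an earliest arrival.  Comparing the batch with the numbers \<open>?c i\<close> of
  gradients that can be finished by \<open>t\<close> shows both that each reception happens by \<open>t\<close> and that the
  number of receptions is bounded.
\<close>

lemma loop_ends_in_time:
  assumes mono: "\<And>i. i \<in> {1..n} \<Longrightarrow> mono_on {0..} (V i)"
    and cont: "\<And>i. i \<in> {1..n} \<Longrightarrow> continuous_on {0..} (V i)"
    and s: "0 \<le> s" "s \<le> t" and n: "n \<ge> 1" and S: "S > 0"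
    and enough: "ereal (S / real n) \<le> harmonic_mean n (\<lambda>i. of_int \<lfloor>V i t - V i s\<rfloor>)"
    and next_worker: "\<And>m. (\<forall>l\<le>m. loop_continues n S w l) \<Longrightarrow> w m \<in> {1..n} \<and>
      (\<forall>i\<in>{1..n}. finish_time (V (w m)) s (received w m (w m) + 1)
                  \<le> finish_time (V i) s (received w m i + 1))"
  defines "N \<equiv> num_receptions n S w"
  shows "(\<exists>m. \<not> loop_continues n S w m) \<and>
    finish_time (V (w (N - 1))) s (received w N (w (N - 1))) \<le> ereal t"
proof -
  let ?c = "\<lambda>i. \<lfloor>V i t - V i s\<rfloor>"
  have c0: "0 \<le> ?c i" if "i \<in> {1..n}" for i
    using mono_onD[OF mono[OF that], of s t] s by simp
  have in_time: "int (received w m (w m) + 1) \<le> ?c (w m) \<and> w m \<in> {1..n}"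
    if running: "\<forall>l\<le>m. loop_continues n S w l" for m
  proof -
    \<comment> \<open>Otherwise the batch dominates \<open>?c\<close>, and the loop would have ended by monotonicity of the harmonic mean.\<close>
    have "\<exists>i\<in>{1..n}. int (received w m i) < ?c i"
    proof (rule ccontr)
      assume "\<not> ?thesis"
      then have "\<And>i. i \<in> {1..n} \<Longrightarrow> ?c i \<le> int (received w m i)" by force
      then have "real_of_int (?c i) \<le> real (received w m i)" if "i \<in> {1..n}" for i
        using that by (metis of_int_le_iff of_int_of_nat_eq)
      then have "harmonic_mean n (\<lambda>i. of_int (?c i)) \<le> harmonic_mean n (\<lambda>i. real (received w m i))"
        using c0 by (intro harmonic_mean_mono) auto
      with enough have "\<not> loop_continues n S w m"
        unfolding not_loop_continues_iff by (rule order.trans)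
      with running show False by simp
    qed
    then obtain i where i: "i \<in> {1..n}" "int (received w m i + 1) \<le> ?c i" by force
    then have "finish_time (V i) s (received w m i + 1) \<le> ereal t"
      using finish_time_le_iff[OF mono cont s] by blast
    with next_worker[OF running] i(1)
    have "finish_time (V (w m)) s (received w m (w m) + 1) \<le> ereal t" "w m \<in> {1..n}"
      by (blast intro: order.trans)+
    then show ?thesis using finish_time_le_iff[OF mono cont s] by blast
  qed
  have bounded: "int (received w m i) \<le> ?c i"
    if "i \<in> {1..n}" "\<forall>l<m. loop_continues n S w l" for i m
    using that
  proof (induction m)
    case (Suc m)
    then show ?case using in_time[of m] by (auto simp: less_Suc_eq_le)
  qed (use c0 in auto)
  have ends: "\<exists>m. \<not> loop_continues n S w m"
  proof (rule ccontr)
    assume forever: "\<not> ?thesis"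
    \<comment> \<open>One reception more than the workers can deliver in total by time \<open>t\<close>.\<close>
    define m where "m = nat (\<Sum>i=1..n. ?c i) + 1"
    have "int m = (\<Sum>i=1..n. int (received w m i))"
      using sum_received[of m w n] in_time forever by (metis of_nat_sum)
    also have "\<dots> \<le> (\<Sum>i=1..n. ?c i)" using forever by (intro sum_mono bounded) auto
    finally show False unfolding m_def by linarith
  qed
  have "\<not> loop_continues n S w N" unfolding N_def by (rule num_receptions_ends[OF ends])
  \<comment> \<open>The loop starts with an empty batch, so there is at least one reception.\<close>
  moreover have "loop_continues n S w 0"
    unfolding loop_continues_def using harmonic_mean_eq_0[of 1 n] n S by (simp add: zero_ereal_def)
  ultimately have N: "N = Suc (N - 1)" by (cases N) auto
  have "\<forall>l\<le>N - 1. loop_continues n S w l"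
    using not_less_Least[of _ "\<lambda>m. \<not> loop_continues n S w m"] N
    unfolding N_def num_receptions_def by (metis less_Suc_eq_le)
  then have "int (received w (N - 1) (w (N - 1)) + 1) \<le> ?c (w (N - 1)) \<and> w (N - 1) \<in> {1..n}"
    by (rule in_time)
  moreover have "received w N (w (N - 1)) = received w (N - 1) (w (N - 1)) + 1"
    by (subst N) simp
  ultimately show ?thesis using ends finish_time_le_iff[OF mono cont s] by metis
qed

lemma iteration_time_nonneg: "0 \<le> iteration_time n V S J k"
proof (induction k)
  case (Suc k)
  then have "0 \<le> real_of_ereal (iteration_time n V S J k)" by (rule real_of_ereal_pos)
  then have "0 \<le> finish_time W (real_of_ereal (iteration_time n V S J k)) b" for W b
    using finish_time_ge[of "real_of_ereal (iteration_time n V S J k)" W b]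
    by (metis ereal_less_eq(5) order.trans)
  then show ?case by (simp add: Let_def)
qed simp

lemma tbar_nonneg: "0 \<le> tbar n V \<sigma> \<epsilon> k"
  by (induction k) (auto intro!: Inf_greatest)

text \<open>
  Rounding up at most doubles a number that exceeds 1, and a number up to 1 is rounded to at
  most 1, hence to at most \<open>n\<close>.  This is where the factor 2 in the definition of \<open>tbar\<close> comes from.
\<close>

lemma batch_threshold:
  assumes n: "n \<ge> 1" and \<epsilon>: "\<epsilon> > 0"
  shows "max (of_int \<lceil>\<sigma>\<^sup>2 / \<epsilon>\<rceil>) (real n) / real n \<le> max (2 * \<sigma>\<^sup>2 / (real n * \<epsilon>)) 1"
proof (cases "\<sigma>\<^sup>2 / \<epsilon> \<le> 1")
  case True
  moreover have "1 \<le> real n" using n by simp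
  ultimately have "\<sigma>\<^sup>2 / \<epsilon> \<le> real n" by (rule order.trans)
  then have "\<lceil>\<sigma>\<^sup>2 / \<epsilon>\<rceil> \<le> int n" by (simp add: ceiling_le_iff)
  then have "of_int \<lceil>\<sigma>\<^sup>2 / \<epsilon>\<rceil> \<le> real n" by linarith
  then show ?thesis using n by simp
next
  case False
  then have "of_int \<lceil>\<sigma>\<^sup>2 / \<epsilon>\<rceil> \<le> 2 * (\<sigma>\<^sup>2 / \<epsilon>)" by linarith
  then have "of_int \<lceil>\<sigma>\<^sup>2 / \<epsilon>\<rceil> / real n \<le> 2 * (\<sigma>\<^sup>2 / \<epsilon>) / real n"
    by (rule divide_right_mono) simp
  also have "\<dots> = 2 * \<sigma>\<^sup>2 / (real n * \<epsilon>)" by simp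
  finally have "of_int \<lceil>\<sigma>\<^sup>2 / \<epsilon>\<rceil> / real n \<le> max (2 * \<sigma>\<^sup>2 / (real n * \<epsilon>)) 1" by simp
  then show ?thesis using n by (cases "of_int \<lceil>\<sigma>\<^sup>2 / \<epsilon>\<rceil> \<le> real n") (simp_all add: max_def)
qed

text \<open>
  By induction an iteration starts no later than its \<open>tbar\<close>; since the \<open>V i\<close> are monotone, more
  gradients are then finished by any given time, and \<open>loop_ends_in_time\<close> applies.
\<close>

lemma iteration_time_le_tbar:
  assumes mono: "\<And>i. i \<in> {1..n} \<Longrightarrow> mono_on {0..} (V i)"
    and cont: "\<And>i. i \<in> {1..n} \<Longrightarrow> continuous_on {0..} (V i)"
    and n: "n \<ge> 1" and S: "S > 0" "S / real n \<le> max (2 * \<sigma>\<^sup>2 / (real n * \<epsilon>)) 1"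
    and J: "valid_schedule n V S J"
  shows "iteration_time n V S J k \<le> tbar n V \<sigma> \<epsilon> k"
proof (induction k)
  case (Suc k)
  let ?h = "\<lambda>t s. harmonic_mean n (\<lambda>i. of_int \<lfloor>V i t - V i s\<rfloor>)"
  let ?thr = "max (2 * \<sigma>\<^sup>2 / (real n * \<epsilon>)) 1"
  show ?case
  proof (cases "tbar n V \<sigma> \<epsilon> k = \<infinity>")
    case False
    then obtain r where r: "tbar n V \<sigma> \<epsilon> k = ereal r" "0 \<le> r"
      using tbar_nonneg[of n V \<sigma> \<epsilon> k] by (cases "tbar n V \<sigma> \<epsilon> k") auto
    obtain s where s: "iteration_time n V S J k = ereal s" "0 \<le> s" "s \<le> r"
      using Suc r iteration_time_nonneg[of n V S J k] by (cases "iteration_time n V S J k") auto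
    have "iteration_time n V S J (Suc k) \<le> ereal t"
      if t: "0 \<le> t" "ereal ?thr \<le> ?h t r" for t
    proof -
      have "r \<le> t"
      proof (rule ccontr)
        assume "\<not> r \<le> t"
        have "of_int \<lfloor>V i t - V i r\<rfloor> \<le> (0::real)" if "i \<in> {1..n}" for i
          using mono_onD[OF mono[OF that], of t r] t(1) \<open>\<not> r \<le> t\<close>
          by (simp add: floor_le_iff)
        then have "?h t r \<le> 0" by (rule harmonic_mean_nonpos[OF _ n])
        moreover have "1 \<le> ?h t r" using t(2) by (simp add: one_ereal_def)
        ultimately have "(1::ereal) \<le> 0" by (rule order.trans[rotated])
        then show False by simp
      qed
      have "?h t r \<le> ?h t s"
        using \<open>r \<le> t\<close> s r
        by (intro harmonic_mean_mono)
          (auto intro!: floor_mono mono_onD[OF mono])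
      with S(2) t(2) have enough: "ereal (S / real n) \<le> ?h t s"
        by (meson ereal_less_eq(3) order.trans)
      have next_worker: "J k m \<in> {1..n} \<and>
        (\<forall>i\<in>{1..n}. finish_time (V (J k m)) s (received (J k) m (J k m) + 1)
                    \<le> finish_time (V i) s (received (J k) m i + 1))"
        if "\<forall>l\<le>m. loop_continues n S (J k) l" for m
      proof -
        have "iteration_time n V S J k < \<infinity>" "real_of_ereal (iteration_time n V S J k) = s"
          using s(1) by simp_all
        with J that show ?thesis unfolding valid_schedule_def Let_def by metis
      qed
      have "s \<le> t" using s \<open>r \<le> t\<close> by simp
      from loop_ends_in_time[where V = V, OF mono cont s(2) this n S(1) enough next_worker]
      show ?thesis using s(1) by (simp add: Let_def)
    qed
    then have "iteration_time n V S J (Suc k) \<le> Inf {ereal t | t. 0 \<le> t \<and> ereal ?thr \<le> ?h t r}"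
      by (intro Inf_greatest) blast
    then show ?thesis using r by (simp del: iteration_time.simps ereal_max)
  qed simp
qed simp

lemma iteration_time_finite_imp_loop_ends:
  assumes "iteration_time n V S J k < \<infinity>" "l < k"
  shows "\<exists>m. \<not> loop_continues n S (J l) m"
  using assms
proof (induction k)
  case (Suc k)
  then have "iteration_time n V S J k < \<infinity>" and ends: "\<exists>m. \<not> loop_continues n S (J k) m"
    by (simp_all split: if_splits)
  with Suc.IH have "l < k \<Longrightarrow> \<exists>m. \<not> loop_continues n S (J l) m" by blast
  with ends Suc.prems(2) show ?case by (cases "l = k") (blast, simp)
qed simp

lemma cumulative_mono_on:
  fixes v :: "real \<Rightarrow> real"
  assumes "\<And>t. 0 \<le> t \<Longrightarrow> 0 \<le> v t" "\<And>t. 0 \<le> t \<Longrightarrow> v integrable_on {0..t}"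
  shows "mono_on {0..} (\<lambda>t. integral {0..t} v)"
  using assms by (intro mono_onI integral_subset_le) auto

lemma cumulative_continuous_on:
  fixes v :: "real \<Rightarrow> real"
  assumes "\<And>t. 0 \<le> t \<Longrightarrow> v integrable_on {0..t}"
  shows "continuous_on {0..} (\<lambda>t. integral {0..t} v)"
proof -
  have "continuous (at t within {0..}) (\<lambda>t. integral {0..t} v)" if "0 \<le> t" for t
  proof -
    have "continuous_on {0..t+1} (\<lambda>t. integral {0..t} v)"
      using assms that by (intro indefinite_integral_continuous_1) auto
    then have "continuous (at t within {0..t+1}) (\<lambda>t. integral {0..t} v)"
      using that by (simp add: continuous_on_eq_continuous_within)
    moreover have "at t within {0..t+1} = at t within {0..}"
      by (rule at_within_nhd[of t "{..<t+1}"]) auto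
    ultimately show ?thesis by simp
  qed
  then show ?thesis by (simp add: continuous_on_eq_continuous_within)
qed

section \<open>Noise at fresh samples\<close>

context prob_space
begin

text \<open>
  Conditioning without conditional expectations: \<open>Z\<close> stands for the past and \<open>Y\<close> for a fresh sample
  of law \<open>D\<close>.  The joint law is a product, so by Fubini one may integrate over the sample first, for
  a fixed past \<open>z\<close>, where \<open>h z\<close> has mean 0 and second moment at most \<open>u\<close>.  The product with
  \<open>c (Z \<omega>)\<close> is integrable because both factors are square integrable.
\<close>

lemma fresh_noise_orthogonal:
  fixes c :: "'z \<Rightarrow> 'e::euclidean_space" and h :: "'z \<Rightarrow> 's \<Rightarrow> 'e"
  assumes Z [measurable]: "Z \<in> measurable M A" and Y [measurable]: "Y \<in> measurable M D"
    and joint: "distr M (A \<Otimes>\<^sub>M D) (\<lambda>\<omega>. (Z \<omega>, Y \<omega>)) = distr M A Z \<Otimes>\<^sub>M D"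
    and law: "distr M D Y = D"
    and c [measurable]: "c \<in> borel_measurable A" and c2: "integrable M (\<lambda>\<omega>. (norm (c (Z \<omega>)))\<^sup>2)"
    and h [measurable]: "case_prod h \<in> borel_measurable (A \<Otimes>\<^sub>M D)"
    and mean: "\<And>z. z \<in> space A \<Longrightarrow> has_bochner_integral D (h z) 0"
    and var: "\<And>z. z \<in> space A \<Longrightarrow> (\<integral>\<^sup>+y. ennreal ((norm (h z y))\<^sup>2) \<partial>D) \<le> ennreal u" and "0 \<le> u"
  shows "integrable M (\<lambda>\<omega>. (norm (h (Z \<omega>) (Y \<omega>)))\<^sup>2)"
    and "expectation (\<lambda>\<omega>. (norm (h (Z \<omega>) (Y \<omega>)))\<^sup>2) \<le> u"
    and "integrable M (\<lambda>\<omega>. c (Z \<omega>) \<bullet> h (Z \<omega>) (Y \<omega>))"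
    and "expectation (\<lambda>\<omega>. c (Z \<omega>) \<bullet> h (Z \<omega>) (Y \<omega>)) = 0"
proof -
  interpret Z: prob_space "distr M A Z" by (rule prob_space_distr) simp
  interpret D: prob_space D using prob_space_distr[OF Y] by (simp add: law)
  interpret ZD: pair_prob_space "distr M A Z" D ..
  have sets_joint [measurable_cong]: "sets (distr M A Z \<Otimes>\<^sub>M D) = sets (A \<Otimes>\<^sub>M D)"
    by (rule sets_pair_measure_cong) auto
  have "(\<integral>\<^sup>+\<omega>. ennreal ((norm (h (Z \<omega>) (Y \<omega>)))\<^sup>2) \<partial>M)
      = (\<integral>\<^sup>+p. ennreal ((norm (case_prod h p))\<^sup>2) \<partial>(distr M A Z \<Otimes>\<^sub>M D))"
    unfolding joint[symmetric] by (subst nn_integral_distr) auto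
  also have "\<dots> = (\<integral>\<^sup>+z. \<integral>\<^sup>+y. ennreal ((norm (h z y))\<^sup>2) \<partial>D \<partial>distr M A Z)"
    by (subst D.nn_integral_fst[symmetric]) auto
  also have "\<dots> \<le> (\<integral>\<^sup>+z. ennreal u \<partial>distr M A Z)"
    by (intro nn_integral_mono var) simp
  also have "\<dots> = ennreal u" using Z.emeasure_space_1 by simp
  finally have le: "(\<integral>\<^sup>+\<omega>. ennreal ((norm (h (Z \<omega>) (Y \<omega>)))\<^sup>2) \<partial>M) \<le> ennreal u" .
  show int_h: "integrable M (\<lambda>\<omega>. (norm (h (Z \<omega>) (Y \<omega>)))\<^sup>2)"
    using le by (intro integrableI_bounded) (auto simp: less_top[symmetric] top_unique)
  show "expectation (\<lambda>\<omega>. (norm (h (Z \<omega>) (Y \<omega>)))\<^sup>2) \<le> u"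
    using le \<open>0 \<le> u\<close> by (simp add: nn_integral_eq_integral[OF int_h])
  show int: "integrable M (\<lambda>\<omega>. c (Z \<omega>) \<bullet> h (Z \<omega>) (Y \<omega>))"
  proof (rule Bochner_Integration.integrable_bound[OF Bochner_Integration.integrable_add[OF c2 int_h]])
    show "AE \<omega> in M. norm (c (Z \<omega>) \<bullet> h (Z \<omega>) (Y \<omega>))
        \<le> norm ((norm (c (Z \<omega>)))\<^sup>2 + (norm (h (Z \<omega>) (Y \<omega>)))\<^sup>2)"
    proof (rule AE_I2)
      fix \<omega>
      let ?a = "norm (c (Z \<omega>))" and ?b = "norm (h (Z \<omega>) (Y \<omega>))"
      have "\<bar>c (Z \<omega>) \<bullet> h (Z \<omega>) (Y \<omega>)\<bar> \<le> ?a * ?b" by (rule Cauchy_Schwarz_ineq2)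
      also have "\<dots> \<le> ?a\<^sup>2 + ?b\<^sup>2"
        using sum_squares_bound[of ?a ?b] mult_nonneg_nonneg[of ?a ?b, OF norm_ge_zero norm_ge_zero]
        by (simp only: mult.assoc)
      finally show "norm (c (Z \<omega>) \<bullet> h (Z \<omega>) (Y \<omega>)) \<le> norm (?a\<^sup>2 + ?b\<^sup>2)" by simp
    qed
  qed simp
  have "expectation (\<lambda>\<omega>. c (Z \<omega>) \<bullet> h (Z \<omega>) (Y \<omega>))
      = (\<integral>p. c (fst p) \<bullet> case_prod h p \<partial>(distr M A Z \<Otimes>\<^sub>M D))"
    unfolding joint[symmetric] by (subst integral_distr) auto
  also have "\<dots> = (\<integral>z. \<integral>y. c z \<bullet> h z y \<partial>D \<partial>distr M A Z)"
  proof -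
    have "integrable (distr M A Z \<Otimes>\<^sub>M D) (\<lambda>p. c (fst p) \<bullet> case_prod h p)"
      unfolding joint[symmetric] using int by (subst integrable_distr_eq) auto
    from ZD.integral_fst'[OF this] show ?thesis by simp
  qed
  also have "\<dots> = (\<integral>z. 0 \<partial>distr M A Z)"
  proof (rule Bochner_Integration.integral_cong)
    fix z assume "z \<in> space (distr M A Z)"
    then have "has_bochner_integral D (\<lambda>y. c z \<bullet> h z y) (c z \<bullet> 0)"
      by (intro has_bochner_integral_inner_right mean) simp
    then show "(\<integral>y. c z \<bullet> h z y \<partial>D) = 0" by (simp add: has_bochner_integral_integral_eq)
  qed simp
  finally show "expectation (\<lambda>\<omega>. c (Z \<omega>) \<bullet> h (Z \<omega>) (Y \<omega>)) = 0" by simp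
qed

text \<open>
  Independence of two variables is a statement about variables with values in one common type.
  Therefore the single sample is first seen as a family over a singleton and then projected.
\<close>

lemma joint_law_restrict:
  assumes indep: "indep_vars D Y I" and H: "H \<subseteq> I" "i \<in> I" "i \<notin> H"
  defines "Z \<equiv> \<lambda>\<omega>. restrict (\<lambda>j. Y j \<omega>) H"
  shows "Z \<in> measurable M (PiM H D)" and "Y i \<in> measurable M (D i)"
    and "distr M (PiM H D \<Otimes>\<^sub>M D i) (\<lambda>\<omega>. (Z \<omega>, Y i \<omega>)) = distr M (PiM H D) Z \<Otimes>\<^sub>M distr M (D i) (Y i)"
proof -
  let ?R = "\<lambda>\<omega>. restrict (\<lambda>j. Y j \<omega>) {i}"
  have ind: "indep_var (PiM H D) Z (PiM {i} D) ?R"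
    unfolding Z_def using H by (intro indep_var_restrict[OF indep]) auto
  have Z' [measurable]: "Z \<in> measurable M (PiM H D)" and R [measurable]: "?R \<in> measurable M (PiM {i} D)"
    using ind by (blast dest: indep_var_rv1 indep_var_rv2)+
  show "Z \<in> measurable M (PiM H D)" by (rule Z')
  have comp [measurable]: "(\<lambda>\<rho>. \<rho> i) \<in> measurable (PiM {i} D) (D i)"
    by (rule measurable_component_singleton) simp
  have Y_R: "Y i = (\<lambda>\<omega>. ?R \<omega> i)" by simp
  show Y: "Y i \<in> measurable M (D i)" by (subst Y_R) measurable
  interpret Yi: prob_space "distr M (D i) (Y i)" by (rule prob_space_distr[OF Y])
  have Yi: "distr M (D i) (Y i) = distr (distr M (PiM {i} D) ?R) (D i) (\<lambda>\<rho>. \<rho> i)"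
    by (subst distr_distr) (auto simp: comp_def)
  have "distr M (PiM H D) Z \<Otimes>\<^sub>M distr M (D i) (Y i)
      = distr (distr M (PiM H D) Z) (PiM H D) (\<lambda>z. z) \<Otimes>\<^sub>M distr (distr M (PiM {i} D) ?R) (D i) (\<lambda>\<rho>. \<rho> i)"
    by (simp add: Yi distr_id2)
  also have "\<dots> = distr (distr M (PiM H D) Z \<Otimes>\<^sub>M distr M (PiM {i} D) ?R) (PiM H D \<Otimes>\<^sub>M D i) (\<lambda>(z, \<rho>). (z, \<rho> i))"
    using Yi.sigma_finite_measure_axioms by (intro pair_measure_distr) (simp_all add: Yi)
  also have "distr M (PiM H D) Z \<Otimes>\<^sub>M distr M (PiM {i} D) ?R
      = distr M (PiM H D \<Otimes>\<^sub>M PiM {i} D) (\<lambda>\<omega>. (Z \<omega>, ?R \<omega>))"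
    using ind indep_var_distribution_eq by blast
  also have "distr \<dots> (PiM H D \<Otimes>\<^sub>M D i) (\<lambda>(z, \<rho>). (z, \<rho> i))
      = distr M (PiM H D \<Otimes>\<^sub>M D i) (\<lambda>\<omega>. (Z \<omega>, Y i \<omega>))"
    by (subst distr_distr) (auto simp: comp_def)
  finally show "distr M (PiM H D \<Otimes>\<^sub>M D i) (\<lambda>\<omega>. (Z \<omega>, Y i \<omega>))
      = distr M (PiM H D) Z \<Otimes>\<^sub>M distr M (D i) (Y i)" by simp
qed

text \<open>
  The samples of the mini-batch \<open>T\<close> are added one at a time.  When \<open>i\<close> is added, its term is fresh
  with respect to the history \<open>H\<close> together with the samples added before, and this enlarged past
  determines both \<open>q (x \<omega>)\<close> and the partial sum.  So the new term is orthogonal to both: the second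
  moments add up, and the inner product with \<open>q (x \<omega>)\<close> keeps expectation 0.
\<close>

lemma minibatch_noise:
  fixes X :: "('i \<Rightarrow> 's) \<Rightarrow> 'e::euclidean_space" and h :: "'i \<Rightarrow> 'e \<Rightarrow> 's \<Rightarrow> 'e"
  assumes indep: "indep_vars D Y I" and law: "\<And>i. i \<in> T \<Longrightarrow> distr M (D i) (Y i) = D i"
    and T: "finite T" "T \<subseteq> I" and H: "H \<subseteq> I" "T \<inter> H = {}"
    and X [measurable]: "X \<in> borel_measurable (PiM H D)" and q [measurable]: "q \<in> borel_measurable borel"
    and h: "\<And>i. i \<in> T \<Longrightarrow> case_prod (h i) \<in> borel_measurable (borel \<Otimes>\<^sub>M D i)"
    and mean: "\<And>i y. i \<in> T \<Longrightarrow> has_bochner_integral (D i) (h i y) 0"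
    and var: "\<And>i y. i \<in> T \<Longrightarrow> (\<integral>\<^sup>+s. ennreal ((norm (h i y s))\<^sup>2) \<partial>D i) \<le> ennreal (u i)"
    and u: "\<And>i. i \<in> T \<Longrightarrow> 0 \<le> u i"
  defines "x \<equiv> \<lambda>\<omega>. X (restrict (\<lambda>i. Y i \<omega>) H)"
  assumes q2: "integrable M (\<lambda>\<omega>. (norm (q (x \<omega>) :: 'e))\<^sup>2)"
  shows "integrable M (\<lambda>\<omega>. (norm (\<Sum>i\<in>T. h i (x \<omega>) (Y i \<omega>)))\<^sup>2) \<and>
    expectation (\<lambda>\<omega>. (norm (\<Sum>i\<in>T. h i (x \<omega>) (Y i \<omega>)))\<^sup>2) \<le> (\<Sum>i\<in>T. u i) \<and>
    integrable M (\<lambda>\<omega>. q (x \<omega>) \<bullet> (\<Sum>i\<in>T. h i (x \<omega>) (Y i \<omega>))) \<and>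
    expectation (\<lambda>\<omega>. q (x \<omega>) \<bullet> (\<Sum>i\<in>T. h i (x \<omega>) (Y i \<omega>))) = 0"
  using T(1) T(2-) H(2) law h mean var u
proof (induction T)
  case (insert i T)
  let ?H = "H \<union> T"
  define Z where "Z \<omega> = restrict (\<lambda>i. Y i \<omega>) ?H" for \<omega>
  define point where "point \<rho> = X (restrict \<rho> H)" for \<rho>
  define part where "part \<rho> = (\<Sum>j\<in>T. h j (point \<rho>) (\<rho> j))" for \<rho>
  have point_Z: "point (Z \<omega>) = x \<omega>" for \<omega>
    unfolding point_def Z_def x_def by (simp add: Int_absorb1 Int_commute)
  have part_Z: "part (Z \<omega>) = (\<Sum>j\<in>T. h j (x \<omega>) (Y j \<omega>))" for \<omega>
    unfolding part_def point_Z by (simp add: Z_def)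
  have [measurable]: "point \<in> borel_measurable (PiM ?H D)"
    unfolding point_def by measurable
  have part_meas [measurable]: "part \<in> borel_measurable (PiM ?H D)"
    unfolding part_def
  proof (rule borel_measurable_sum)
    fix j assume j: "j \<in> T"
    have [measurable]: "case_prod (h j) \<in> borel_measurable (borel \<Otimes>\<^sub>M D j)"
      using insert.prems j by blast
    have [measurable]: "(\<lambda>\<rho>. \<rho> j) \<in> measurable (PiM ?H D) (D j)"
      using j by (intro measurable_component_singleton) auto
    show "(\<lambda>\<rho>. h j (point \<rho>) (\<rho> j)) \<in> borel_measurable (PiM ?H D)" by measurable
  qed
  have [measurable]: "case_prod (h i) \<in> borel_measurable (borel \<Otimes>\<^sub>M D i)"
    using insert.prems by blast
  have law_i: "distr M (D i) (Y i) = D i" and u_i: "0 \<le> u i" using insert.prems by auto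
  have "?H \<subseteq> I" "i \<in> I" "i \<notin> ?H" using insert.prems insert.hyps H(1) by auto
  from joint_law_restrict[OF indep this]
  have joint: "Z \<in> measurable M (PiM ?H D)" "Y i \<in> measurable M (D i)"
    "distr M (PiM ?H D \<Otimes>\<^sub>M D i) (\<lambda>\<omega>. (Z \<omega>, Y i \<omega>)) = distr M (PiM ?H D) Z \<Otimes>\<^sub>M D i"
    unfolding law_i Z_def .
  have IH: "integrable M (\<lambda>\<omega>. (norm (part (Z \<omega>)))\<^sup>2)"
    "expectation (\<lambda>\<omega>. (norm (part (Z \<omega>)))\<^sup>2) \<le> (\<Sum>i\<in>T. u i)"
    "integrable M (\<lambda>\<omega>. q (x \<omega>) \<bullet> part (Z \<omega>))"
    "expectation (\<lambda>\<omega>. q (x \<omega>) \<bullet> part (Z \<omega>)) = 0"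
    using insert.IH insert.prems unfolding part_Z by auto
  have q2': "integrable M (\<lambda>\<omega>. (norm (q (point (Z \<omega>))))\<^sup>2)" using q2 by (simp add: point_Z)
  have h_i: "(\<lambda>(\<rho>, s). h i (point \<rho>) s) \<in> borel_measurable (PiM ?H D \<Otimes>\<^sub>M D i)"
    by measurable
  have mean_i: "has_bochner_integral (D i) (h i (point \<rho>)) 0" for \<rho>
    by (rule insert.prems(5)) simp
  have var_i: "(\<integral>\<^sup>+s. ennreal ((norm (h i (point \<rho>) s))\<^sup>2) \<partial>D i) \<le> ennreal (u i)" for \<rho>
    by (rule insert.prems(6)) simp
  note part_step = fresh_noise_orthogonal[OF joint law_i part_meas IH(1) h_i mean_i var_i u_i]
  have "(\<lambda>\<rho>. q (point \<rho>)) \<in> borel_measurable (PiM ?H D)" by measurable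
  note q_step = fresh_noise_orthogonal[OF joint law_i this q2' h_i mean_i var_i u_i]
  have sq: "(norm (\<Sum>j\<in>insert i T. h j (x \<omega>) (Y j \<omega>)))\<^sup>2 = (norm (part (Z \<omega>)))\<^sup>2
      + 2 * (part (Z \<omega>) \<bullet> h i (point (Z \<omega>)) (Y i \<omega>)) + (norm (h i (point (Z \<omega>)) (Y i \<omega>)))\<^sup>2" for \<omega>
    using insert.hyps
    by (simp add: part_Z point_Z power2_norm_eq_inner inner_add_left inner_add_right inner_commute)
  have qs: "q (x \<omega>) \<bullet> (\<Sum>j\<in>insert i T. h j (x \<omega>) (Y j \<omega>))
      = q (x \<omega>) \<bullet> part (Z \<omega>) + q (point (Z \<omega>)) \<bullet> h i (point (Z \<omega>)) (Y i \<omega>)" for \<omega>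
    using insert.hyps by (simp add: part_Z point_Z inner_add_right)
  show ?case unfolding sq qs using IH part_step q_step insert.hyps by simp
qed simp_all

text \<open>
  Expanding the descent inequality at the step \<open>- \<gamma> (\<nabla>f(x) + e)\<close> gives a term linear in \<open>e\<close>, whose
  expectation vanishes, and a multiple of \<open>\<parallel>e\<parallel>\<^sup>2\<close>; the condition \<open>L * \<gamma> \<le> 1\<close> absorbs half of the
  decrease.  Integrability of \<open>f (x' \<omega>)\<close> follows since it lies between \<open>fstar\<close> and an integrable
  bound.
\<close>

lemma sgd_step:
  fixes f :: "'e::euclidean_space \<Rightarrow> real" and x e :: "'a \<Rightarrow> 'e"
  assumes descent: "\<And>y d. f (y + d) \<le> f y + gradient f y \<bullet> d + L / 2 * (norm d)\<^sup>2"
    and bounded: "\<And>y. fstar \<le> f y" and \<gamma>: "0 \<le> \<gamma>" "L * \<gamma> \<le> 1" and L: "0 \<le> L"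
    and f_meas: "f \<in> borel_measurable borel"
    and meas [measurable]: "x \<in> borel_measurable M" "e \<in> borel_measurable M"
    and fx: "integrable M (\<lambda>\<omega>. f (x \<omega>))"
    and gx: "integrable M (\<lambda>\<omega>. (norm (gradient f (x \<omega>)))\<^sup>2)"
    and e: "integrable M (\<lambda>\<omega>. (norm (e \<omega>))\<^sup>2)" "expectation (\<lambda>\<omega>. (norm (e \<omega>))\<^sup>2) \<le> u"
    and ge: "integrable M (\<lambda>\<omega>. gradient f (x \<omega>) \<bullet> e \<omega>)"
      "expectation (\<lambda>\<omega>. gradient f (x \<omega>) \<bullet> e \<omega>) = 0"
  defines "x' \<equiv> \<lambda>\<omega>. x \<omega> - \<gamma> *\<^sub>R (gradient f (x \<omega>) + e \<omega>)"
  assumes x'_meas [measurable]: "x' \<in> borel_measurable M"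
  shows "integrable M (\<lambda>\<omega>. f (x' \<omega>))"
    and "expectation (\<lambda>\<omega>. f (x' \<omega>)) \<le> expectation (\<lambda>\<omega>. f (x \<omega>))
      - \<gamma> / 2 * expectation (\<lambda>\<omega>. (norm (gradient f (x \<omega>)))\<^sup>2) + L * \<gamma>\<^sup>2 / 2 * u"
proof -
  let ?g = "\<lambda>\<omega>. gradient f (x \<omega>)"
  define r where "r \<omega> = f (x \<omega>) - \<gamma> / 2 * (norm (?g \<omega>))\<^sup>2
      + (L * \<gamma>\<^sup>2 - \<gamma>) * (?g \<omega> \<bullet> e \<omega>) + L * \<gamma>\<^sup>2 / 2 * (norm (e \<omega>))\<^sup>2" for \<omega>
  have step: "f (x' \<omega>) \<le> r \<omega>" for \<omega>
  proof -
    let ?d = "(- \<gamma>) *\<^sub>R (?g \<omega> + e \<omega>)"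
    have nd: "(norm ?d)\<^sup>2 = \<gamma>\<^sup>2 * ((norm (?g \<omega>))\<^sup>2 + 2 * (?g \<omega> \<bullet> e \<omega>) + (norm (e \<omega>))\<^sup>2)"
      by (simp add: power_mult_distrib power2_norm_eq_inner inner_add_left inner_add_right inner_commute)
    have gd: "?g \<omega> \<bullet> ?d = - \<gamma> * (norm (?g \<omega>))\<^sup>2 - \<gamma> * (?g \<omega> \<bullet> e \<omega>)"
      by (simp add: power2_norm_eq_inner inner_add_right algebra_simps)
    have "f (x' \<omega>) = f (x \<omega> + ?d)" by (simp add: x'_def)
    also have "\<dots> \<le> f (x \<omega>) + ?g \<omega> \<bullet> ?d + L / 2 * (norm ?d)\<^sup>2" by (rule descent)
    also have "\<dots> = r \<omega> - (1 - L * \<gamma>) * (\<gamma> / 2 * (norm (?g \<omega>))\<^sup>2)"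
      unfolding nd gd r_def by (simp add: field_simps power2_eq_square)
    also have "\<dots> \<le> r \<omega>" using \<gamma> by simp
    finally show ?thesis .
  qed
  have r: "integrable M r" unfolding r_def[abs_def] using fx gx e ge by simp
  show int: "integrable M (\<lambda>\<omega>. f (x' \<omega>))"
  proof (rule Bochner_Integration.integrable_bound)
    show "integrable M (\<lambda>\<omega>. \<bar>r \<omega>\<bar> + \<bar>fstar\<bar>)" using r by simp
    show "(\<lambda>\<omega>. f (x' \<omega>)) \<in> borel_measurable M" using f_meas by measurable
    show "AE \<omega> in M. norm (f (x' \<omega>)) \<le> norm (\<bar>r \<omega>\<bar> + \<bar>fstar\<bar>)"
    proof (rule AE_I2)
      fix \<omega>
      show "norm (f (x' \<omega>)) \<le> norm (\<bar>r \<omega>\<bar> + \<bar>fstar\<bar>)"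
        using step[of \<omega>] bounded[of "x' \<omega>"] by (simp add: abs_if)
    qed
  qed
  have "expectation (\<lambda>\<omega>. f (x' \<omega>)) \<le> expectation r"
    by (rule integral_mono[OF int r step])
  also have "\<dots> = expectation (\<lambda>\<omega>. f (x \<omega>)) - \<gamma> / 2 * expectation (\<lambda>\<omega>. (norm (?g \<omega>))\<^sup>2)
      + L * \<gamma>\<^sup>2 / 2 * expectation (\<lambda>\<omega>. (norm (e \<omega>))\<^sup>2)"
    unfolding r_def[abs_def] using fx gx e ge by simp
  also have "\<dots> \<le> expectation (\<lambda>\<omega>. f (x \<omega>)) - \<gamma> / 2 * expectation (\<lambda>\<omega>. (norm (?g \<omega>))\<^sup>2)
      + L * \<gamma>\<^sup>2 / 2 * u"
    using e(2) L by (intro add_left_mono mult_left_mono) auto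
  finally show "expectation (\<lambda>\<omega>. f (x' \<omega>)) \<le> expectation (\<lambda>\<omega>. f (x \<omega>))
      - \<gamma> / 2 * expectation (\<lambda>\<omega>. (norm (?g \<omega>))\<^sup>2) + L * \<gamma>\<^sup>2 / 2 * u" .
qed

end

section \<open>The iterates of Malenia SGD\<close>

lemma grad_sum_eq: "grad_sum G x \<xi> w m i = (\<Sum>b=1..received w m i. G i x (\<xi> i b))"
  by (induction m arbitrary: i) (auto simp: Let_def)

definition averaged_gradient where
  "averaged_gradient n B G x \<xi> = (1 / real n) *\<^sub>R
     (\<Sum>i=1..n. (1 / real (B i)) *\<^sub>R (\<Sum>b=1..B i. G i x (\<xi> i b)))"

abbreviation final_batch :: "nat \<Rightarrow> real \<Rightarrow> (nat \<Rightarrow> nat) \<Rightarrow> nat \<Rightarrow> nat" where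
  "final_batch n S w \<equiv> received w (num_receptions n S w)"

lemma malenia_sgd_Suc:
  "malenia_sgd n S \<gamma> G \<xi> J x0 (Suc k) = malenia_sgd n S \<gamma> G \<xi> J x0 k
     - \<gamma> *\<^sub>R averaged_gradient n (final_batch n S (J k)) G (malenia_sgd n S \<gamma> G \<xi> J x0 k) (\<xi> k)"
  by (simp add: Let_def grad_sum_eq averaged_gradient_def)

lemma averaged_gradient_cong:
  assumes "\<And>i b. i \<in> {1..n} \<Longrightarrow> b \<ge> 1 \<Longrightarrow> \<xi> i b = \<xi>' i b"
  shows "averaged_gradient n B G x \<xi> = averaged_gradient n B G x \<xi>'"
  unfolding averaged_gradient_def using assms by (auto intro!: sum.cong arg_cong2[where f = "(*\<^sub>R)"])

text \<open>
  The \<open>k\<close>-th iterate depends only on samples of earlier iterations.  Together with the next lemma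
  this exhibits it as a measurable function of a history that is independent of iteration \<open>k\<close>.
\<close>

lemma malenia_sgd_cong:
  assumes "\<And>l i b. l < k \<Longrightarrow> i \<in> {1..n} \<Longrightarrow> b \<ge> 1 \<Longrightarrow> \<xi> l i b = \<xi>' l i b"
  shows "malenia_sgd n S \<gamma> G \<xi> J x0 k = malenia_sgd n S \<gamma> G \<xi>' J x0 k"
  using assms
proof (induction k)
  case (Suc k)
  then have "malenia_sgd n S \<gamma> G \<xi> J x0 k = malenia_sgd n S \<gamma> G \<xi>' J x0 k" by simp
  moreover have "averaged_gradient n B G y (\<xi> k) = averaged_gradient n B G y (\<xi>' k)" for B y
    using Suc.prems by (intro averaged_gradient_cong) auto
  ultimately show ?case unfolding malenia_sgd_Suc by metis
qed simp

lemma malenia_sgd_measurable: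
  fixes G :: "nat \<Rightarrow> 'e::euclidean_space \<Rightarrow> 's \<Rightarrow> 'e"
  assumes G: "\<And>i. i \<in> {1..n} \<Longrightarrow> case_prod (G i) \<in> borel_measurable (borel \<Otimes>\<^sub>M D i)"
    and H: "{..<k} \<times> {1..n} \<times> {1..} \<subseteq> H"
  shows "(\<lambda>\<rho>. malenia_sgd n S \<gamma> G (\<lambda>l j b. \<rho> (l, j, b)) J x0 k)
    \<in> borel_measurable (PiM H (\<lambda>(l, j, b). D j))"
  using H
proof (induction k)
  case (Suc k)
  then have [measurable]: "(\<lambda>\<rho>. malenia_sgd n S \<gamma> G (\<lambda>l j b. \<rho> (l, j, b)) J x0 k)
      \<in> borel_measurable (PiM H (\<lambda>(l, j, b). D j))"
    by fastforce
  have "(\<lambda>\<rho>. G i (malenia_sgd n S \<gamma> G (\<lambda>l j b. \<rho> (l, j, b)) J x0 k) (\<rho> (k, i, b)))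
      \<in> borel_measurable (PiM H (\<lambda>(l, j, b). D j))" if i: "i \<in> {1..n}" and b: "b \<ge> 1" for i b
  proof -
    have [measurable]: "(\<lambda>\<rho>. \<rho> (k, i, b)) \<in> measurable (PiM H (\<lambda>(l, j, b). D j)) (D i)"
      using measurable_component_singleton[of "(k, i, b)" H "\<lambda>(l, j, b). D j"] Suc.prems i b by force
    note G[OF i, measurable]
    show ?thesis by measurable
  qed
  then show ?case unfolding malenia_sgd_Suc averaged_gradient_def
    by (intro borel_measurable_diff borel_measurable_scaleR borel_measurable_sum) auto
qed simp

text \<open>
  Every worker gets total weight \<open>1 / n\<close> whatever its batch size, so the averaged gradient is centred
  at the mean of the vectors \<open>d i\<close>.
\<close>

lemma averaged_gradient_error:
  fixes G :: "nat \<Rightarrow> 'e::real_vector \<Rightarrow> 's \<Rightarrow> 'e"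
  assumes B: "\<And>i. i \<in> {1..n} \<Longrightarrow> 0 < B i"
  shows "averaged_gradient n B G x \<xi> = (1 / real n) *\<^sub>R (\<Sum>i=1..n. d i)
    + (\<Sum>i=1..n. \<Sum>b=1..B i. (1 / (real n * real (B i))) *\<^sub>R (G i x (\<xi> i b) - d i))"
proof -
  have "(1 / real n) *\<^sub>R ((1 / real (B i)) *\<^sub>R (\<Sum>b=1..B i. G i x (\<xi> i b))) = (1 / real n) *\<^sub>R d i
      + (\<Sum>b=1..B i. (1 / (real n * real (B i))) *\<^sub>R (G i x (\<xi> i b) - d i))" if "i \<in> {1..n}" for i
    using B[OF that]
    by (simp add: scaleR_sum_right[symmetric] sum_subtractf scaleR_right_diff_distrib sum_constant_scaleR)
  then show ?thesis by (simp add: averaged_gradient_def scaleR_sum_right sum.distrib)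
qed

text \<open>
  The smoothness constant is positive here: for \<open>L = 0\<close> the number of iterations in the theorem is 0.
\<close>

locale stochastic_optimization = prob_space M for M :: "'o measure" +
  fixes n :: nat and fs :: "nat \<Rightarrow> 'e::euclidean_space \<Rightarrow> real" and f :: "'e \<Rightarrow> real"
    and L fstar \<sigma> :: real and D :: "nat \<Rightarrow> 's measure" and G :: "nat \<Rightarrow> 'e \<Rightarrow> 's \<Rightarrow> 'e"
    and \<xi> :: "nat \<Rightarrow> nat \<Rightarrow> nat \<Rightarrow> 'o \<Rightarrow> 's"
  assumes n: "n \<ge> 1"
    and mean_f: "f = (\<lambda>y. (1 / real n) * (\<Sum>i=1..n. fs i y))"
    and fs_diff: "\<And>i y. i \<in> {1..n} \<Longrightarrow> fs i differentiable (at y)"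
    and f_diff: "\<And>y. f differentiable (at y)"
    and f_smooth: "\<And>y z. norm (gradient f y - gradient f z) \<le> L * norm (y - z)"
    and f_bounded: "\<And>y. fstar \<le> f y"
    and L: "L > 0"
    and D_prob: "\<And>i. i \<in> {1..n} \<Longrightarrow> prob_space (D i)"
    and G_meas: "\<And>i. i \<in> {1..n} \<Longrightarrow> case_prod (G i) \<in> borel_measurable (borel \<Otimes>\<^sub>M D i)"
    and G_unbiased: "\<And>i y. i \<in> {1..n} \<Longrightarrow> has_bochner_integral (D i) (G i y) (gradient (fs i) y)"
    and G_variance: "\<And>i y. i \<in> {1..n} \<Longrightarrow>
          (\<integral>\<^sup>+ s. ennreal ((norm (G i y s - gradient (fs i) y))\<^sup>2) \<partial>D i) \<le> ennreal (\<sigma>\<^sup>2)"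
    and \<xi>_indep: "indep_vars (\<lambda>(k, j, b). D j) (\<lambda>(k, j, b). \<xi> k j b) (UNIV \<times> {1..n} \<times> {1..})"
    and \<xi>_distr: "\<And>k j b. j \<in> {1..n} \<Longrightarrow> b \<ge> 1 \<Longrightarrow> distr M (D j) (\<xi> k j b) = D j"
begin

lemma f_measurable: "f \<in> borel_measurable borel"
  using f_diff
  by (intro borel_measurable_continuous_onI continuous_at_imp_continuous_on ballI
      differentiable_imp_continuous_within)

lemma gradient_measurable: "gradient f \<in> borel_measurable borel"
proof (rule borel_measurable_continuous_onI)
  have "L-lipschitz_on UNIV (gradient f)"
    using f_smooth L by (intro lipschitz_onI) (auto simp: dist_norm)
  then show "continuous_on UNIV (gradient f)" by (rule lipschitz_on_continuous_on)
qed

text \<open>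
  The gradients of the \<open>fs i\<close> need not be continuous; they are measurable as expectations of the
  stochastic gradients.
\<close>

lemma gradient_summand_measurable:
  assumes i: "i \<in> {1..n}" shows "gradient (fs i) \<in> borel_measurable borel"
proof -
  interpret D: prob_space "D i" by (rule D_prob[OF i])
  have "gradient (fs i) = (\<lambda>y. \<integral>s. G i y s \<partial>D i)"
    using G_unbiased[OF i] by (simp add: has_bochner_integral_iff fun_eq_iff)
  then show ?thesis using D.borel_measurable_lebesgue_integral[OF G_meas[OF i]] by simp
qed

lemma scaled_deviation:
  assumes i: "i \<in> {1..n}"
  shows "case_prod (\<lambda>y s. a *\<^sub>R (G i y s - gradient (fs i) y)) \<in> borel_measurable (borel \<Otimes>\<^sub>M D i)"
    and "has_bochner_integral (D i) (\<lambda>s. a *\<^sub>R (G i y s - gradient (fs i) y)) 0"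
    and "(\<integral>\<^sup>+ s. ennreal ((norm (a *\<^sub>R (G i y s - gradient (fs i) y)))\<^sup>2) \<partial>D i) \<le> ennreal (a\<^sup>2 * \<sigma>\<^sup>2)"
proof -
  interpret D: prob_space "D i" by (rule D_prob[OF i])
  note G_meas[OF i, measurable] gradient_summand_measurable[OF i, measurable]
  show "case_prod (\<lambda>y s. a *\<^sub>R (G i y s - gradient (fs i) y)) \<in> borel_measurable (borel \<Otimes>\<^sub>M D i)"
    by measurable
  have [simp]: "integrable (D i) (G i y)" "integral\<^sup>L (D i) (G i y) = gradient (fs i) y"
    using G_unbiased[OF i, of y] by (auto simp: has_bochner_integral_iff)
  have meas [measurable]: "G i y \<in> borel_measurable (D i)"
    using \<open>integrable (D i) (G i y)\<close> by (rule borel_measurable_integrable)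
  show "has_bochner_integral (D i) (\<lambda>s. a *\<^sub>R (G i y s - gradient (fs i) y)) 0"
    by (simp add: has_bochner_integral_iff D.prob_space)
  have "(\<integral>\<^sup>+ s. ennreal ((norm (a *\<^sub>R (G i y s - gradient (fs i) y)))\<^sup>2) \<partial>D i)
      = ennreal (a\<^sup>2) * (\<integral>\<^sup>+ s. ennreal ((norm (G i y s - gradient (fs i) y))\<^sup>2) \<partial>D i)"
    by (subst nn_integral_cmult[symmetric]) (auto simp: power_mult_distrib ennreal_mult)
  also have "\<dots> \<le> ennreal (a\<^sup>2) * ennreal (\<sigma>\<^sup>2)" by (intro mult_left_mono G_variance i) auto
  finally show "(\<integral>\<^sup>+ s. ennreal ((norm (a *\<^sub>R (G i y s - gradient (fs i) y)))\<^sup>2) \<partial>D i)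
      \<le> ennreal (a\<^sup>2 * \<sigma>\<^sup>2)" by (simp add: ennreal_mult)
qed

lemma gradient_square_integrable:
  assumes X: "X \<in> borel_measurable M" and fX: "integrable M (\<lambda>\<omega>. f (X \<omega>))"
  shows "integrable M (\<lambda>\<omega>. (norm (gradient f (X \<omega>)))\<^sup>2)"
proof (rule Bochner_Integration.integrable_bound)
  show "integrable M (\<lambda>\<omega>. 2 * L * (f (X \<omega>) - fstar))" using fX by simp
  show "(\<lambda>\<omega>. (norm (gradient f (X \<omega>)))\<^sup>2) \<in> borel_measurable M"
    using measurable_compose[OF X gradient_measurable] by simp
  show "AE \<omega> in M. norm ((norm (gradient f (X \<omega>)))\<^sup>2) \<le> norm (2 * L * (f (X \<omega>) - fstar))"
  proof (rule AE_I2)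
    fix \<omega>
    have "1 / L / 2 * (norm (gradient f (X \<omega>)))\<^sup>2 \<le> f (X \<omega>) - fstar"
      using L by (intro gradient_step_decrease[OF f_diff f_smooth f_bounded]) auto
    then have "(norm (gradient f (X \<omega>)))\<^sup>2 \<le> 2 * L * (f (X \<omega>) - fstar)"
      using L by (simp add: field_simps)
    then show "norm ((norm (gradient f (X \<omega>)))\<^sup>2) \<le> norm (2 * L * (f (X \<omega>) - fstar))" by simp
  qed
qed

lemma malenia_iterate_measurable:
  "(\<lambda>\<omega>. malenia_sgd n S \<gamma> G (\<lambda>k j b. \<xi> k j b \<omega>) J x0 l) \<in> borel_measurable M"
proof -
  let ?I = "UNIV \<times> {1..n} \<times> {1..} :: (nat \<times> nat \<times> nat) set"
  let ?D = "\<lambda>(k::nat, j, b::nat). D j" and ?\<xi> = "\<lambda>(k, j, b). \<xi> k j b"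
  have "?\<xi> p \<in> measurable M (?D p)" if "p \<in> ?I" for p
    using \<xi>_indep that unfolding indep_vars_def by blast
  then have "(\<lambda>\<omega>. restrict (\<lambda>p. ?\<xi> p \<omega>) ?I) \<in> measurable M (PiM ?I ?D)"
    by (intro measurable_restrict)
  from measurable_compose[OF this malenia_sgd_measurable[where k = l and n = n and S = S and \<gamma> = \<gamma> and J = J and ?x0.0 = x0, OF G_meas]]
  have "(\<lambda>\<omega>. malenia_sgd n S \<gamma> G (\<lambda>l j b. restrict (\<lambda>p. ?\<xi> p \<omega>) ?I (l, j, b)) J x0 l)
      \<in> borel_measurable M" by auto
  also have "(\<lambda>\<omega>. malenia_sgd n S \<gamma> G (\<lambda>l j b. restrict (\<lambda>p. ?\<xi> p \<omega>) ?I (l, j, b)) J x0 l)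
      = (\<lambda>\<omega>. malenia_sgd n S \<gamma> G (\<lambda>k j b. \<xi> k j b \<omega>) J x0 l)"
    by (intro ext malenia_sgd_cong) auto
  finally show ?thesis .
qed

text \<open>
  The samples of iteration \<open>k\<close> are indexed by \<open>T\<close> and the earlier ones by \<open>H\<close>.  Worker \<open>i\<close>
  contributes \<open>B i\<close> centred terms of weight \<open>a i = 1 / (n * B i)\<close>, so the noise has second moment at
  most \<open>(\<Sum>i. B i * (a i)\<^sup>2 * \<sigma>\<^sup>2) = \<sigma>\<^sup>2 / n * (1 / n * (\<Sum>i. 1 / B i))\<close>, and the stopping criterion
  bounds the last factor by \<open>n / S\<close>.
\<close>

lemma malenia_step:
  fixes S \<gamma> :: real and J :: "nat \<Rightarrow> nat \<Rightarrow> nat" and x0 :: 'e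
  defines "x \<equiv> \<lambda>k \<omega>. malenia_sgd n S \<gamma> G (\<lambda>k j b. \<xi> k j b \<omega>) J x0 k"
  assumes \<gamma>: "0 < \<gamma>" "L * \<gamma> \<le> 1" and S: "S > 0"
    and ends: "\<exists>m. \<not> loop_continues n S (J k) m"
    and fx: "integrable M (\<lambda>\<omega>. f (x k \<omega>))"
  shows "integrable M (\<lambda>\<omega>. f (x (Suc k) \<omega>))"
    and "expectation (\<lambda>\<omega>. f (x (Suc k) \<omega>)) \<le> expectation (\<lambda>\<omega>. f (x k \<omega>))
      - \<gamma> / 2 * expectation (\<lambda>\<omega>. (norm (gradient f (x k \<omega>)))\<^sup>2) + L * \<gamma>\<^sup>2 / 2 * (\<sigma>\<^sup>2 / S)"
proof -
  let ?I = "UNIV \<times> {1..n} \<times> {1..} :: (nat \<times> nat \<times> nat) set"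
  let ?D = "\<lambda>(k::nat, j, b::nat). D j" and ?\<xi> = "\<lambda>(k, j, b). \<xi> k j b"
  define H where "H = {..<k} \<times> {1..n} \<times> {1::nat..}"
  define B where "B = final_batch n S (J k)"
  define T where "T = {k} \<times> (SIGMA i:{1..n}. {1..B i})"
  define a where "a i = 1 / (real n * real (B i))" for i
  define h where "h = (\<lambda>(l::nat, i, b::nat) y s. a i *\<^sub>R (G i y s - gradient (fs i) y))"
  define e where "e \<omega> = (\<Sum>p\<in>T. h p (x k \<omega>) (?\<xi> p \<omega>))" for \<omega>
  define X where "X \<rho> = malenia_sgd n S \<gamma> G (\<lambda>l j b. \<rho> (l, j, b)) J x0 k" for \<rho>
  have sum_T: "(\<Sum>p\<in>T. g p) = (\<Sum>i=1..n. \<Sum>b=1..B i. g (k, i, b))"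
    for g :: "nat \<times> nat \<times> nat \<Rightarrow> 'z::comm_monoid_add"
  proof -
    have "T = Pair k ` (SIGMA i:{1..n}. {1..B i})" by (auto simp: T_def)
    then show ?thesis by (simp add: sum.reindex inj_on_def sum.Sigma split_def)
  qed
  have "\<not> loop_continues n S (J k) (num_receptions n S (J k))"
    by (rule num_receptions_ends[OF ends])
  then have "ereal (S / real n) \<le> harmonic_mean n (\<lambda>i. real (B i))"
    by (simp add: not_loop_continues_iff B_def)
  from harmonic_mean_ge_pos[OF _ n this]
  have B: "\<And>i. i \<in> {1..n} \<Longrightarrow> 0 < B i" and B_mean: "(1 / real n) * (\<Sum>i=1..n. 1 / real (B i)) \<le> real n / S"
    using S n by auto

  have "(\<Sum>(l, i, b)\<in>T. (a i)\<^sup>2 * \<sigma>\<^sup>2) = (\<Sum>i=1..n. real (B i) * ((a i)\<^sup>2 * \<sigma>\<^sup>2))"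
    by (simp add: sum_T)
  also have "\<dots> = (\<Sum>i=1..n. \<sigma>\<^sup>2 / real n * ((1 / real n) * (1 / real (B i))))"
  proof (rule sum.cong)
    fix i assume "i \<in> {1..n}"
    from B[OF this] show "real (B i) * ((a i)\<^sup>2 * \<sigma>\<^sup>2)
        = \<sigma>\<^sup>2 / real n * ((1 / real n) * (1 / real (B i)))"
      by (simp add: a_def field_simps power2_eq_square)
  qed simp
  also have "\<dots> = \<sigma>\<^sup>2 / real n * ((1 / real n) * (\<Sum>i=1..n. 1 / real (B i)))"
    by (simp only: sum_distrib_left)
  also have "\<dots> \<le> \<sigma>\<^sup>2 / real n * (real n / S)" by (intro mult_left_mono B_mean) simp
  also have "\<dots> = \<sigma>\<^sup>2 / S" using n by simp
  finally have variance: "(\<Sum>(l, i, b)\<in>T. (a i)\<^sup>2 * \<sigma>\<^sup>2) \<le> \<sigma>\<^sup>2 / S" .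

  have x_X: "x k \<omega> = X (restrict (\<lambda>p. ?\<xi> p \<omega>) H)" for \<omega>
    unfolding x_def X_def by (rule malenia_sgd_cong) (auto simp: H_def)
  have X_meas: "X \<in> borel_measurable (PiM H ?D)"
    unfolding X_def[abs_def] by (rule malenia_sgd_measurable[OF G_meas]) (auto simp: H_def)
  have x_meas: "x l \<in> borel_measurable M" for l
    unfolding x_def by (rule malenia_iterate_measurable)
  have gx: "integrable M (\<lambda>\<omega>. (norm (gradient f (x k \<omega>)))\<^sup>2)"
    by (rule gradient_square_integrable[OF x_meas fx])
  have noise: "integrable M (\<lambda>\<omega>. (norm (e \<omega>))\<^sup>2) \<and>
      expectation (\<lambda>\<omega>. (norm (e \<omega>))\<^sup>2) \<le> (\<Sum>(l, i, b)\<in>T. (a i)\<^sup>2 * \<sigma>\<^sup>2) \<and>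
      integrable M (\<lambda>\<omega>. gradient f (x k \<omega>) \<bullet> e \<omega>) \<and>
      expectation (\<lambda>\<omega>. gradient f (x k \<omega>) \<bullet> e \<omega>) = 0"
    unfolding e_def x_X
  proof (rule minibatch_noise[OF \<xi>_indep])
    show "finite T" "T \<subseteq> ?I" "H \<subseteq> ?I" "T \<inter> H = {}" by (auto simp: T_def H_def)
    show "integrable M (\<lambda>\<omega>. (norm (gradient f (X (restrict (\<lambda>p. ?\<xi> p \<omega>) H))))\<^sup>2)"
      using gx by (simp only: x_X)
    fix p assume p: "p \<in> T"
    then obtain i b where pib: "p = (k, i, b)" "i \<in> {1..n}" "b \<ge> 1" by (auto simp: T_def)
    show "distr M (?D p) (?\<xi> p) = ?D p" using pib \<xi>_distr by simp
    show "case_prod (h p) \<in> borel_measurable (borel \<Otimes>\<^sub>M ?D p)"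
      "has_bochner_integral (?D p) (h p y) 0"
      "(\<integral>\<^sup>+ s. ennreal ((norm (h p y s))\<^sup>2) \<partial>?D p) \<le> ennreal (case p of (l, i, b) \<Rightarrow> (a i)\<^sup>2 * \<sigma>\<^sup>2)" for y
      using scaled_deviation[OF pib(2)] by (simp_all add: pib h_def)
    show "0 \<le> (case p of (l, i, b) \<Rightarrow> (a i)\<^sup>2 * \<sigma>\<^sup>2)" by (simp add: pib)
  qed (use X_meas gradient_measurable in auto)
  have x_Suc: "x (Suc k) = (\<lambda>\<omega>. x k \<omega> - \<gamma> *\<^sub>R (gradient f (x k \<omega>) + e \<omega>))"
  proof
    fix \<omega>
    have "gradient f (x k \<omega>) = (1 / real n) *\<^sub>R (\<Sum>i=1..n. gradient (fs i) (x k \<omega>))"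
      unfolding mean_f by (rule gradient_scaled_sum) (rule fs_diff)
    moreover have "e \<omega> = (\<Sum>i=1..n. \<Sum>b=1..B i. a i *\<^sub>R (G i (x k \<omega>) (\<xi> k i b \<omega>) - gradient (fs i) (x k \<omega>)))"
      by (simp add: e_def sum_T h_def)
    moreover have "x (Suc k) \<omega> = x k \<omega> - \<gamma> *\<^sub>R averaged_gradient n B G (x k \<omega>) (\<lambda>i b. \<xi> k i b \<omega>)"
      unfolding x_def B_def by (rule malenia_sgd_Suc)
    ultimately show "x (Suc k) \<omega> = x k \<omega> - \<gamma> *\<^sub>R (gradient f (x k \<omega>) + e \<omega>)"
      using averaged_gradient_error[where n = n and B = B and G = G and x = "x k \<omega>"
          and \<xi> = "\<lambda>i b. \<xi> k i b \<omega>" and d = "\<lambda>i. gradient (fs i) (x k \<omega>)", OF B]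
      by (simp add: a_def)
  qed
  have e_meas: "e \<in> borel_measurable M"
  proof -
    have "e = (\<lambda>\<omega>. (1 / \<gamma>) *\<^sub>R (x k \<omega> - x (Suc k) \<omega>) - gradient f (x k \<omega>))"
      using \<gamma> by (simp add: x_Suc fun_eq_iff)
    then show ?thesis using x_meas measurable_compose[OF x_meas gradient_measurable] by simp
  qed
  show "integrable M (\<lambda>\<omega>. f (x (Suc k) \<omega>))"
    and "expectation (\<lambda>\<omega>. f (x (Suc k) \<omega>)) \<le> expectation (\<lambda>\<omega>. f (x k \<omega>))
      - \<gamma> / 2 * expectation (\<lambda>\<omega>. (norm (gradient f (x k \<omega>)))\<^sup>2) + L * \<gamma>\<^sup>2 / 2 * (\<sigma>\<^sup>2 / S)"
    using sgd_step[where f = f and x = "x k" and e = e and u = "\<sigma>\<^sup>2 / S",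
        OF descent_inequality[OF f_diff f_smooth] f_bounded _ \<gamma>(2) _ f_measurable
          x_meas e_meas fx gx] noise variance x_meas[of "Suc k"] \<gamma> L
    unfolding x_Suc by auto
qed

lemma malenia_descent:
  fixes S \<gamma> :: real and J :: "nat \<Rightarrow> nat \<Rightarrow> nat" and x0 :: 'e
  defines "x \<equiv> \<lambda>k \<omega>. malenia_sgd n S \<gamma> G (\<lambda>k j b. \<xi> k j b \<omega>) J x0 k"
  assumes \<gamma>: "0 < \<gamma>" "L * \<gamma> \<le> 1" and S: "S > 0"
    and ends: "\<And>l. l < k \<Longrightarrow> \<exists>m. \<not> loop_continues n S (J l) m"
  shows "integrable M (\<lambda>\<omega>. f (x k \<omega>)) \<and> expectation (\<lambda>\<omega>. f (x k \<omega>)) \<le> f x0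
      - \<gamma> / 2 * (\<Sum>l<k. expectation (\<lambda>\<omega>. (norm (gradient f (x l \<omega>)))\<^sup>2))
      + real k * (L * \<gamma>\<^sup>2 / 2 * (\<sigma>\<^sup>2 / S))"
  using ends
proof (induction k)
  case 0
  show ?case by (simp add: x_def prob_space)
next
  case (Suc k)
  then have IH: "integrable M (\<lambda>\<omega>. f (x k \<omega>))" "expectation (\<lambda>\<omega>. f (x k \<omega>)) \<le> f x0
      - \<gamma> / 2 * (\<Sum>l<k. expectation (\<lambda>\<omega>. (norm (gradient f (x l \<omega>)))\<^sup>2))
      + real k * (L * \<gamma>\<^sup>2 / 2 * (\<sigma>\<^sup>2 / S))" by auto
  have "integrable M (\<lambda>\<omega>. f (x (Suc k) \<omega>))"
    "expectation (\<lambda>\<omega>. f (x (Suc k) \<omega>)) \<le> expectation (\<lambda>\<omega>. f (x k \<omega>))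
      - \<gamma> / 2 * expectation (\<lambda>\<omega>. (norm (gradient f (x k \<omega>)))\<^sup>2) + L * \<gamma>\<^sup>2 / 2 * (\<sigma>\<^sup>2 / S)"
    using malenia_step[OF \<gamma> S, of J k x0] Suc.prems IH(1) unfolding x_def by auto
  moreover define c where "c = L * \<gamma>\<^sup>2 / 2 * (\<sigma>\<^sup>2 / S)"
  moreover define E where "E l = expectation (\<lambda>\<omega>. (norm (gradient f (x l \<omega>)))\<^sup>2)" for l
  ultimately show ?case using IH(2) unfolding c_def[symmetric] E_def[symmetric]
    by (simp add: algebra_simps)
qed

text \<open>
  Only the first \<open>K - 1\<close> loops are known to end.  The last iterate is therefore followed by an exact
  gradient step rather than a stochastic one.  The noise contributes \<open>L * \<gamma> * \<sigma>\<^sup>2 / S\<close>, at most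
  \<open>\<epsilon> / 2\<close>, to the average, and the initial gap contributes \<open>2 * (f x0 - fstar) / (\<gamma> * K)\<close>; the
  latter is at most \<open>\<epsilon> / 2\<close> as soon as \<open>K\<close> has the size required here.
\<close>

lemma malenia_average_gradient:
  fixes S \<gamma> \<epsilon> :: real and J :: "nat \<Rightarrow> nat \<Rightarrow> nat" and x0 :: 'e
  defines "x \<equiv> \<lambda>k \<omega>. malenia_sgd n S \<gamma> G (\<lambda>k j b. \<xi> k j b \<omega>) J x0 k"
  assumes \<gamma>: "1 / (2 * L) \<le> \<gamma>" "\<gamma> \<le> 1 / L" "L * \<gamma> * \<sigma>\<^sup>2 / S \<le> \<epsilon> / 2" and S: "S > 0"
    and K: "K \<ge> 1" "8 * L * (f x0 - fstar) / \<epsilon> \<le> real K" and \<epsilon>: "\<epsilon> > 0"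
    and ends: "\<And>l. Suc l < K \<Longrightarrow> \<exists>m. \<not> loop_continues n S (J l) m"
  shows "k < K \<Longrightarrow> integrable M (\<lambda>\<omega>. (norm (gradient f (x k \<omega>)))\<^sup>2)"
    and "(1 / real K) * (\<Sum>k<K. expectation (\<lambda>\<omega>. (norm (gradient f (x k \<omega>)))\<^sup>2)) \<le> \<epsilon>"
proof -
  let ?E = "\<lambda>k. expectation (\<lambda>\<omega>. (norm (gradient f (x k \<omega>)))\<^sup>2)"
  let ?c = "L * \<gamma>\<^sup>2 / 2 * (\<sigma>\<^sup>2 / S)"
  have \<gamma>0: "0 < \<gamma>" using \<gamma>(1) L by (meson divide_pos_pos less_le_trans mult_pos_pos zero_less_numeral zero_less_one)
  have \<gamma>1: "L * \<gamma> \<le> 1" using \<gamma>(2) L by (simp add: field_simps)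
  have descent: "integrable M (\<lambda>\<omega>. f (x k \<omega>))"
    "expectation (\<lambda>\<omega>. f (x k \<omega>)) \<le> f x0 - \<gamma> / 2 * (\<Sum>l<k. ?E l) + real k * ?c" if "k < K" for k
    using malenia_descent[OF \<gamma>0 \<gamma>1 S, of k J x0] ends that unfolding x_def by auto
  show int: "integrable M (\<lambda>\<omega>. (norm (gradient f (x k \<omega>)))\<^sup>2)" if "k < K" for k
    using descent(1)[OF that] unfolding x_def
    by (intro gradient_square_integrable malenia_iterate_measurable)
  obtain m where m: "K = Suc m" using K(1) by (cases K) auto
  have "\<gamma> / 2 * ?E m = expectation (\<lambda>\<omega>. \<gamma> / 2 * (norm (gradient f (x m \<omega>)))\<^sup>2)" by simp
  also have "\<dots> \<le> expectation (\<lambda>\<omega>. f (x m \<omega>) - fstar)"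
    using descent(1)[of m] int[of m] m \<gamma>0 \<gamma>1
    by (intro integral_mono gradient_step_decrease[OF f_diff f_smooth f_bounded]) auto
  also have "\<dots> = expectation (\<lambda>\<omega>. f (x m \<omega>)) - fstar"
    using descent(1)[of m] m by (simp add: prob_space)
  finally have "\<gamma> / 2 * (\<Sum>k<K. ?E k) \<le> f x0 - fstar + real m * ?c"
    using descent(2)[of m] m by (simp add: algebra_simps)
  also have "\<dots> \<le> f x0 - fstar + real K * ?c"
    using m L S by (intro add_left_mono mult_right_mono) auto
  also have "?c = \<gamma> / 2 * (L * \<gamma> * \<sigma>\<^sup>2 / S)" by (simp add: power2_eq_square)
  also have "f x0 - fstar + real K * (\<gamma> / 2 * (L * \<gamma> * \<sigma>\<^sup>2 / S)) \<le> f x0 - fstar + real K * (\<gamma> / 2 * (\<epsilon> / 2))"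
    using \<gamma>0 \<gamma>(3) by (intro add_left_mono mult_left_mono) auto
  also have "f x0 - fstar \<le> real K * \<epsilon> / (8 * L)" using K(2) L \<epsilon> by (simp add: field_simps)
  also have "real K * \<epsilon> / (8 * L) = real K * \<epsilon> / 4 * (1 / (2 * L))" by simp
  also have "\<dots> \<le> real K * \<epsilon> / 4 * \<gamma>" using \<gamma>(1) \<epsilon> by (intro mult_left_mono) auto
  also have "real K * \<epsilon> / 4 * \<gamma> + real K * (\<gamma> / 2 * (\<epsilon> / 2)) = \<gamma> / 2 * (real K * \<epsilon>)" by simp
  finally have "(\<Sum>k<K. ?E k) \<le> real K * \<epsilon>" using \<gamma>0 by simp
  then show "(1 / real K) * (\<Sum>k<K. ?E k) \<le> \<epsilon>" using K(1) by (simp add: field_simps)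
qed

end

section \<open>Convergence in time\<close>

theorem theorem6p4:
  fixes n :: nat
    and fs :: "nat \<Rightarrow> real ^ 'd \<Rightarrow> real" and f :: "real ^ 'd \<Rightarrow> real"
    and L fstar \<sigma> \<epsilon> \<Delta> \<gamma> S :: real
    and D :: "nat \<Rightarrow> 's measure" and G :: "nat \<Rightarrow> real ^ 'd \<Rightarrow> 's \<Rightarrow> real ^ 'd"
    and v V :: "nat \<Rightarrow> real \<Rightarrow> real"
    and J :: "nat \<Rightarrow> nat \<Rightarrow> nat"
    and P :: "'o measure" and \<xi> :: "nat \<Rightarrow> nat \<Rightarrow> nat \<Rightarrow> 'o \<Rightarrow> 's"
    and x0 :: "real ^ 'd" and x :: "nat \<Rightarrow> 'o \<Rightarrow> real ^ 'd"
    and K :: nat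
  assumes n: "n \<ge> 1"
    and f_def: "f = (\<lambda>y. (1 / real n) * (\<Sum>i=1..n. fs i y))"
    and fs_diff: "\<And>i y. i \<in> {1..n} \<Longrightarrow> fs i differentiable (at y)"
    and f_diff: "\<And>y. f differentiable (at y)"
    and f_smooth: "\<And>y z. norm (gradient f y - gradient f z) \<le> L * norm (y - z)"
    and f_bounded: "\<And>y. fstar \<le> f y"
    and D_prob: "\<And>i. i \<in> {1..n} \<Longrightarrow> prob_space (D i)"
    and G_meas: "\<And>i. i \<in> {1..n} \<Longrightarrow> (\<lambda>(y, s). G i y s) \<in> borel_measurable (borel \<Otimes>\<^sub>M D i)"
    and G_unbiased: "\<And>i y. i \<in> {1..n} \<Longrightarrow> has_bochner_integral (D i) (G i y) (gradient (fs i) y)"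
    and G_variance: "\<And>i y. i \<in> {1..n} \<Longrightarrow>
          (\<integral>\<^sup>+ s. ennreal ((norm (G i y s - gradient (fs i) y))\<^sup>2) \<partial>D i) \<le> ennreal (\<sigma>\<^sup>2)"
    and v_nonneg: "\<And>i t. i \<in> {1..n} \<Longrightarrow> 0 \<le> t \<Longrightarrow> 0 \<le> v i t"
    and v_cont: "\<And>i. i \<in> {1..n} \<Longrightarrow>
          AE t in lebesgue. 0 \<le> t \<longrightarrow> continuous (at t within {0..}) (v i)"
    and v_int: "\<And>i t. i \<in> {1..n} \<Longrightarrow> 0 \<le> t \<Longrightarrow> v i integrable_on {0..t}"
    and V_def: "V = (\<lambda>i t. integral {0..t} (v i))"
    and \<epsilon>: "\<epsilon> > 0"
    and \<Delta>_def: "\<Delta> = f x0 - fstar"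
    and S_def: "S = max (of_int \<lceil>\<sigma>\<^sup>2 / \<epsilon>\<rceil>) (real n)"
    and \<gamma>_def: "\<gamma> = (if \<sigma>\<^sup>2 = 0 then 1 / L else min (1 / L) (\<epsilon> * S / (2 * L * \<sigma>\<^sup>2)))"
    and J: "valid_schedule n V S J"
    and P_prob: "prob_space P"
    and \<xi>_indep: "prob_space.indep_vars P (\<lambda>(k, j, b). D j) (\<lambda>(k, j, b). \<xi> k j b)
          (UNIV \<times> {1..n} \<times> {1..})"
    and \<xi>_distr: "\<And>k j b. j \<in> {1..n} \<Longrightarrow> b \<ge> 1 \<Longrightarrow> distr P (D j) (\<xi> k j b) = D j"
    and x_def: "x = (\<lambda>k \<omega>. malenia_sgd n S \<gamma> G (\<lambda>k j b. \<xi> k j b \<omega>) J x0 k)"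
    and K_def: "K = nat \<lceil>24 * L * \<Delta> / \<epsilon>\<rceil>"
  shows "iteration_time n V S J K \<le> tbar n V \<sigma> \<epsilon> K \<and>
    (K \<ge> 1 \<and> iteration_time n V S J (K - 1) < \<infinity> \<longrightarrow>
      (\<forall>k<K. integrable P (\<lambda>\<omega>. (norm (gradient f (x k \<omega>)))\<^sup>2)) \<and>
      (1 / real K) * (\<Sum>k<K. \<integral>\<omega>. (norm (gradient f (x k \<omega>)))\<^sup>2 \<partial>P) \<le> \<epsilon>)"
proof (intro conjI impI)
  have S_pos: "S > 0" using n by (simp add: S_def)
  show "iteration_time n V S J K \<le> tbar n V \<sigma> \<epsilon> K"
  proof (rule iteration_time_le_tbar[OF _ _ n S_pos _ J])
    show "mono_on {0..} (V i)" if "i \<in> {1..n}" for i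
      unfolding V_def using v_nonneg[OF that] v_int[OF that] by (rule cumulative_mono_on)
    show "continuous_on {0..} (V i)" if "i \<in> {1..n}" for i
      unfolding V_def using v_int[OF that] by (rule cumulative_continuous_on)
    show "S / real n \<le> max (2 * \<sigma>\<^sup>2 / (real n * \<epsilon>)) 1"
      unfolding S_def by (rule batch_threshold[OF n \<epsilon>])
  qed
  assume "K \<ge> 1 \<and> iteration_time n V S J (K - 1) < \<infinity>"
  then have K: "K \<ge> 1" and fin: "iteration_time n V S J (K - 1) < \<infinity>" by auto
  \<comment> \<open>Two points at distance 1 show that the Lipschitz constant is nonnegative.\<close>
  obtain y z :: "real ^ 'd" where "norm (y - z) = 1"
    using vector_choose_size[of 1] by (metis diff_zero zero_le_one)
  with f_smooth[of y z] have "norm (gradient f y - gradient f z) \<le> L" by simp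
  then have "0 \<le> L" using norm_ge_zero order.trans by blast
  moreover have "L \<noteq> 0" using K by (auto simp: K_def)
  ultimately have L: "L > 0" by simp
  interpret prob_space P by (rule P_prob)
  interpret stochastic_optimization P n fs f L fstar \<sigma> D G \<xi>
    by (intro stochastic_optimization.intro stochastic_optimization_axioms.intro) (fact P_prob n f_def fs_diff f_diff f_smooth f_bounded L D_prob G_meas
        G_unbiased G_variance \<xi>_indep \<xi>_distr)+
  have S_ge: "\<sigma>\<^sup>2 / \<epsilon> \<le> S" unfolding S_def by linarith
  have \<gamma>: "1 / (2 * L) \<le> \<gamma>" "\<gamma> \<le> 1 / L" "L * \<gamma> * \<sigma>\<^sup>2 / S \<le> \<epsilon> / 2"
  proof -
    show "\<gamma> \<le> 1 / L" by (simp add: \<gamma>_def)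
    show "1 / (2 * L) \<le> \<gamma>"
    proof (cases "\<sigma>\<^sup>2 = 0")
      case False
      then have "0 < \<sigma>\<^sup>2" by (simp add: less_le)
      with S_ge L \<epsilon> have "1 / (2 * L) \<le> \<epsilon> * S / (2 * L * \<sigma>\<^sup>2)" by (simp add: field_simps)
      moreover have "1 / (2 * L) \<le> 1 / L" using L by (simp add: field_simps)
      ultimately show ?thesis by (simp add: \<gamma>_def)
    qed (use L in \<open>simp add: \<gamma>_def field_simps\<close>)
    show "L * \<gamma> * \<sigma>\<^sup>2 / S \<le> \<epsilon> / 2"
    proof (cases "\<sigma>\<^sup>2 = 0")
      case False
      then have \<sigma>: "0 < \<sigma>\<^sup>2" by (simp add: less_le)
      have "\<gamma> \<le> \<epsilon> * S / (2 * L * \<sigma>\<^sup>2)" using False by (simp add: \<gamma>_def)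
      then have "\<gamma> * (2 * L * \<sigma>\<^sup>2) \<le> \<epsilon> * S" using L \<sigma> by (simp add: pos_le_divide_eq)
      then show ?thesis using S_pos by (simp add: pos_divide_le_eq algebra_simps)
    qed (use \<epsilon> in simp)
  qed
  have "0 \<le> \<Delta>" using f_bounded by (simp add: \<Delta>_def)
  then have "8 * L * \<Delta> / \<epsilon> \<le> 24 * L * \<Delta> / \<epsilon>" using L \<epsilon> by (simp add: divide_right_mono)
  also have "\<dots> \<le> real K" unfolding K_def by linarith
  finally have K_ge: "8 * L * (f x0 - fstar) / \<epsilon> \<le> real K" by (simp add: \<Delta>_def)
  have ends: "\<exists>m. \<not> loop_continues n S (J l) m" if "Suc l < K" for l
    using that by (intro iteration_time_finite_imp_loop_ends[OF fin]) simp
  note result = malenia_average_gradient[where ?x0.0 = x0 and J = J, OF \<gamma> S_pos K K_ge \<epsilon> ends]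
  show "\<forall>k<K. integrable P (\<lambda>\<omega>. (norm (gradient f (x k \<omega>)))\<^sup>2)"
    unfolding x_def using result(1) by blast
  show "(1 / real K) * (\<Sum>k<K. \<integral>\<omega>. (norm (gradient f (x k \<omega>)))\<^sup>2 \<partial>P) \<le> \<epsilon>"
    unfolding x_def using result(2) by blast
qed

end
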